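(* \textsc{EL-Multi-STC} can be solved in $\mathcal{O}((c+1)^{k_1}\cdot(cm+nm))$ time, where $n=|V|$, $m=|E|$ for the input graph $G=(V,E)$, and $k_1=k_1(G)$.
   Context: A $c$-labeling of an undirected graph $G=(V,E)$ is a partition $L=(S^1_L,\dots,S^c_L,W_L)$ of $E$; edges in $S^i_L$ are strong (color $i$), edges in $W_L$ are weak. $L$ is an STC-labeling if there is no pair of edges $\{u,v\},\{v,w\}$ in the same $S^i_L$ with $\{u,w\}\notin E$. For $\Psi:E\to 2^{\{1,\dots,c\}}$, $L$ is $\Psi$-satisfying if each edge $e$ is in $W_L$ or in $S^\alpha_L$ for some $\alpha\in\Psi(e)$. \textsc{EL-Multi-STC}: given $(G,c,k,\Psi)$, decide whether a $\Psi$-satisfying STC-labeling with $|W_L|\le k$ exists. The parameter $k_1(G)$ is the minimum number of weak edges $|W_L|$ over all STC-labelings $L=(S^1_L,W_L)$ of $G$ with a single strong color ($c=1$, no list constraints). *)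

theory Defs
  imports Main "HOL-Library.Disjoint_Sets"
begin

section \<open>Multi-STC with edge lists\<close>

definition simple_graph :: "'a set \<Rightarrow> 'a set set \<Rightarrow> bool" where
  "simple_graph V E \<longleftrightarrow> finite V \<and> (\<forall>e\<in>E. e \<subseteq> V \<and> card e = 2)"

text \<open>For a \<open>c\<close>-labeling only the values \<open>strong L i\<close> with \<open>1 \<le> i \<le> c\<close> are relevant.
  Parts of the partition may be empty.\<close>

datatype 'a labeling = Labeling (strong: "nat \<Rightarrow> 'a set set") (weak: "'a set set")

definition c_labeling :: "'a set set \<Rightarrow> nat \<Rightarrow> 'a labeling \<Rightarrow> bool" where
  "c_labeling E c L \<longleftrightarrow>
     (\<Union>i\<in>{1..c}. strong L i) \<union> weak L = E \<and>
     disjoint_family_on (strong L) {1..c} \<and>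
     (\<forall>i\<in>{1..c}. strong L i \<inter> weak L = {})"

text \<open>The condition \<open>u \<noteq> w\<close> says that the two edges are distinct; without it,
  every strong edge would violate the condition, as \<open>{u, u}\<close> is not an edge.\<close>

definition stc_labeling :: "'a set set \<Rightarrow> nat \<Rightarrow> 'a labeling \<Rightarrow> bool" where
  "stc_labeling E c L \<longleftrightarrow> c_labeling E c L \<and>
     \<not> (\<exists>i\<in>{1..c}. \<exists>u v w. u \<noteq> w \<and> {u, v} \<in> strong L i \<and> {v, w} \<in> strong L i \<and> {u, w} \<notin> E)"

definition psi_satisfying :: "'a set set \<Rightarrow> ('a set \<Rightarrow> nat set) \<Rightarrow> 'a labeling \<Rightarrow> bool" where
  "psi_satisfying E \<Psi> L \<longleftrightarrow> (\<forall>e\<in>E. e \<in> weak L \<or> (\<exists>\<alpha>\<in>\<Psi> e. e \<in> strong L \<alpha>))"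

definition el_multi_stc :: "'a set set \<Rightarrow> nat \<Rightarrow> nat \<Rightarrow> ('a set \<Rightarrow> nat set) \<Rightarrow> bool" where
  "el_multi_stc E c k \<Psi> \<longleftrightarrow>
     (\<exists>L. stc_labeling E c L \<and> psi_satisfying E \<Psi> L \<and> card (weak L) \<le> k)"

definition k1 :: "'a set set \<Rightarrow> nat" where
  "k1 E = Min {card (weak L) | L. stc_labeling E 1 L}"


section \<open>Unit-cost random access machine\<close>

text \<open>
  Programs are structured programs for a unit-cost RAM on natural numbers with indirect
  addressing.  The only arithmetic operations are addition and truncated subtraction; there is
  no multiplication, so large numbers cannot be used to do a large amount of work in one step.
  The memory is divided into named banks, of which a program uses finitely many; a scalar
  variable is cell 0 of a bank.  Interleaving the banks gives a single memory at the price of a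
  constant factor.
\<close>

type_synonym state = "string \<Rightarrow> nat \<Rightarrow> nat"

datatype aexp = N nat | Rd string aexp | Plus aexp aexp | Minus aexp aexp

datatype bexp = Less aexp aexp | Eq aexp aexp | Not bexp | And bexp bexp

datatype com =
    Skip
  | Wr string aexp aexp   \<comment> \<open>\<open>Wr x a b\<close> is \<open>x[a] := b\<close>\<close>
  | Seq com com
  | If bexp com com
  | While bexp com

fun aval :: "aexp \<Rightarrow> state \<Rightarrow> nat" where
  "aval (N n) s = n"
| "aval (Rd x a) s = s x (aval a s)"
| "aval (Plus a b) s = aval a s + aval b s"
| "aval (Minus a b) s = aval a s - aval b s"

fun bval :: "bexp \<Rightarrow> state \<Rightarrow> bool" where
  "bval (Less a b) s \<longleftrightarrow> aval a s < aval b s"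
| "bval (Eq a b) s \<longleftrightarrow> aval a s = aval b s"
| "bval (Not b) s \<longleftrightarrow> \<not> bval b s"
| "bval (And b b') s \<longleftrightarrow> bval b s \<and> bval b' s"

fun acost :: "aexp \<Rightarrow> nat" where
  "acost (N n) = 1"
| "acost (Rd x a) = 1 + acost a"
| "acost (Plus a b) = 1 + acost a + acost b"
| "acost (Minus a b) = 1 + acost a + acost b"

fun bcost :: "bexp \<Rightarrow> nat" where
  "bcost (Less a b) = 1 + acost a + acost b"
| "bcost (Eq a b) = 1 + acost a + acost b"
| "bcost (Not b) = 1 + bcost b"
| "bcost (And b b') = 1 + bcost b + bcost b'"

text \<open>\<open>exec p s t s'\<close>: started in \<open>s\<close>, program \<open>p\<close> halts in \<open>s'\<close> after exactly \<open>t\<close> time units.\<close>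

inductive exec :: "com \<Rightarrow> state \<Rightarrow> nat \<Rightarrow> state \<Rightarrow> bool" where
  Skip: "exec Skip s 1 s"
| Wr: "exec (Wr x a b) s (1 + acost a + acost b) (s(x := (s x)(aval a s := aval b s)))"
| Seq: "exec p s t s' \<Longrightarrow> exec q s' t' s'' \<Longrightarrow> exec (Seq p q) s (t + t') s''"
| IfTrue: "bval b s \<Longrightarrow> exec p s t s' \<Longrightarrow> exec (If b p q) s (1 + bcost b + t) s'"
| IfFalse: "\<not> bval b s \<Longrightarrow> exec q s t s' \<Longrightarrow> exec (If b p q) s (1 + bcost b + t) s'"
| WhileFalse: "\<not> bval b s \<Longrightarrow> exec (While b p) s (1 + bcost b) s"
| WhileTrue: "bval b s \<Longrightarrow> exec p s t s' \<Longrightarrow> exec (While b p) s' t' s'' \<Longrightarrow>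
    exec (While b p) s (1 + bcost b + t + t') s''"

lemma exec_deterministic:
  "exec p s t s' \<Longrightarrow> exec p s u s'' \<Longrightarrow> t = u \<and> s' = s''"
proof (induction arbitrary: u s'' rule: exec.induct)
  case Skip
  then show ?case by (auto elim: exec.cases)
next
  case Wr
  then show ?case by (auto elim: exec.cases)
next
  case (Seq p s t s' q t' s'')
  from Seq.prems show ?case by (cases rule: exec.cases) (use Seq.IH in blast)+
next
  case (IfTrue b s p t s' q)
  from IfTrue.prems show ?case by (cases rule: exec.cases) (use IfTrue in blast)+
next
  case (IfFalse b s q t s' p)
  from IfFalse.prems show ?case by (cases rule: exec.cases) (use IfFalse in blast)+
next
  case (WhileFalse b s p)
  from WhileFalse.prems show ?case by (cases rule: exec.cases) (use WhileFalse in blast)+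
next
  case (WhileTrue b s p t s' t' s'')
  from WhileTrue.prems show ?case by (cases rule: exec.cases) (use WhileTrue in blast)+
qed


section \<open>Encoding of the input\<close>

text \<open>The vertex set is \<open>{..<n}\<close>.  The edges are listed once each, in any order and with
  their end points in any order.\<close>

definition lists_edges :: "(nat \<times> nat) list \<Rightarrow> nat set set \<Rightarrow> bool" where
  "lists_edges es E \<longleftrightarrow>
     distinct (map (\<lambda>(u, v). {u, v}) es) \<and> set (map (\<lambda>(u, v). {u, v}) es) = E"

text \<open>The lists \<open>\<Psi>(e)\<close> are given as a 0/1 table with one row of length \<open>c\<close> per edge:
  the entry for edge number \<open>i\<close> (from 0) and color \<open>\<alpha>\<close> (from 1) has index \<open>i * c + (\<alpha> - 1)\<close>.
  All cells that do not hold input are 0.\<close>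

definition input_state ::
  "nat \<Rightarrow> (nat \<times> nat) list \<Rightarrow> nat \<Rightarrow> nat \<Rightarrow> (nat set \<Rightarrow> nat set) \<Rightarrow> state" where
  "input_state n es c k \<Psi> = (\<lambda>x i. 0)
     (''n'' := (\<lambda>i. 0)(0 := n),
      ''m'' := (\<lambda>i. 0)(0 := length es),
      ''c'' := (\<lambda>i. 0)(0 := c),
      ''k'' := (\<lambda>i. 0)(0 := k),
      ''u'' := (\<lambda>i. if i < length es then fst (es ! i) else 0),
      ''v'' := (\<lambda>i. if i < length es then snd (es ! i) else 0),
      ''psi'' := (\<lambda>j. if j < length es * c \<and>
                          j mod c + 1 \<in> \<Psi> {fst (es ! (j div c)), snd (es ! (j div c))}
                       then 1 else 0))"

definition answer :: "state \<Rightarrow> nat" where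
  "answer s = s ''answer'' 0"

end

theory Submission imports Defs begin

text \<open>Two edges are in conflict if they share a vertex and their other end points are not adjacent.
  The weak edges of a labeling with one strong color form a vertex cover of the conflict graph, so
  this graph has a vertex cover of size \<open>k1\<close>. Digit vectors over \<open>{0..c}\<close> of length
  0, 1, 2, \<dots> are enumerated, and each vector guides a greedy scan that settles uncovered conflicts;
  when the length reaches \<open>k1\<close> at the latest, some vector yields a cover that is not longer than the
  vector. The lengths form a geometric progression, so this takes at most \<open>2 * (c + 1) ^ k1\<close> scans of
  cost \<open>O(n * m)\<close>. The edges outside of the cover are pairwise not in conflict. Hence, after the
  at most \<open>(c + 1) ^ k1\<close> ways to color the cover, each of them can independently take any
  admissible color that is not used by a conflicting edge of the cover.\<close>

section \<open>A weakest precondition calculus with running time\<close>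

text \<open>The program neither knows \<open>k1\<close> nor has a recursion stack. Settling
  uncovered conflicts one by one is naturally a branching recursion of unknown depth; a digit vector
  records the branch decisions instead, so a counter replaces the stack, and adding a digit after
  all vectors have failed replaces knowledge of \<open>k1\<close>. The decisions are binary, but
  digits in base c + 1 let one increment routine serve both enumerations, and (c + 1) ^ k1 rounds
  are within the bound anyway. A pass over the conflicts takes O(n * m) steps because a conflict of
  an edge is addressed by the third vertex involved and not by the second edge. Clearing the n * n
  cells of an adjacency table would be too expensive if there are many isolated vertices; the
  initial content 0 of a cell is therefore read as non-adjacency.\<close>

notation Seq (infixr ";;" 60)

abbreviation Var :: "string \<Rightarrow> aexp" where "Var x \<equiv> Rd x (N 0)"

abbreviation Assign :: "string \<Rightarrow> aexp \<Rightarrow> com" (infix "::=" 61) where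
  "x ::= a \<equiv> Wr x (N 0) a"

definition For :: "string \<Rightarrow> string \<Rightarrow> com \<Rightarrow> com" where
  "For x b p = x ::= N 0;; While (Less (Var x) (Var b)) (p;; x ::= Plus (Var x) (N 1))"

fun writes :: "com \<Rightarrow> string set" where
  "writes Skip = {}"
| "writes (Wr x a b) = {x}"
| "writes (p;; q) = writes p \<union> writes q"
| "writes (If b p q) = writes p \<union> writes q"
| "writes (While b p) = writes p"

lemma writes_For [simp]: "writes (For x b p) = insert x (writes p)"
  by (auto simp: For_def)

lemma exec_frame: "exec p s t s' \<Longrightarrow> x \<notin> writes p \<Longrightarrow> s' x = s x"
  by (induction rule: exec.induct) auto

text \<open>\<open>t\<close> is a running clock: a postcondition sees the absolute end time, so
  costs of consecutive commands add up by passing the clock on. A halting run is demanded, hence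
  this is total correctness.\<close>

definition wp :: "com \<Rightarrow> state \<Rightarrow> nat \<Rightarrow> (state \<Rightarrow> nat \<Rightarrow> bool) \<Rightarrow> bool" where
  "wp p s t Q \<longleftrightarrow> (\<exists>t' s'. exec p s t' s' \<and> Q s' (t + t'))"

lemma wp_Skip [simp]: "wp Skip s t Q \<longleftrightarrow> Q s (Suc t)"
  unfolding wp_def by (subst exec.simps) auto

lemma wp_Wr [simp]:
  "wp (Wr x a b) s t Q \<longleftrightarrow>
     Q (s(x := (s x)(aval a s := aval b s))) (t + (1 + acost a + acost b))"
  unfolding wp_def by (subst exec.simps) auto

lemma wp_Seq [simp]: "wp (p;; q) s t Q \<longleftrightarrow> wp p s t (\<lambda>s' t'. wp q s' t' Q)"
proof -
  have "exec (p;; q) s u s' \<longleftrightarrow> (\<exists>v w s''. u = v + w \<and> exec p s v s'' \<and> exec q s'' w s')" for u s'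
    by (subst exec.simps) auto
  then show ?thesis unfolding wp_def by (simp add: add.assoc) (metis add.assoc)
qed

lemma wp_If [simp]:
  "wp (If b p q) s t Q \<longleftrightarrow>
     (if bval b s then wp p s (t + (1 + bcost b)) Q else wp q s (t + (1 + bcost b)) Q)"
proof -
  have "exec (If b p q) s u s' \<longleftrightarrow>
      (\<exists>v. u = 1 + bcost b + v \<and> (if bval b s then exec p s v s' else exec q s v s'))" for u s'
    by (subst exec.simps) auto
  then show ?thesis unfolding wp_def
    by (cases "bval b s"; simp) (metis add_Suc_right add.assoc)+
qed

text \<open>Besides weakening the postcondition, this rule hands over the frame facts for all banks
  that \<open>p\<close> never writes; specifications of subprograms then only mention what
  changes.\<close>

lemma wp_conseq:
  assumes "wp p s t Q"
    and "\<And>s' t'. Q s' t' \<Longrightarrow> (\<And>x. x \<notin> writes p \<Longrightarrow> s' x = s x) \<Longrightarrow> Q' s' t'"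
  shows "wp p s t Q'"
  using assms exec_frame unfolding wp_def by blast

text \<open>The index of the invariant counts rounds and serves as the variant: a true guard forces
  \<open>i < B\<close>, so at most \<open>B - i\<close> rounds remain. The successor in the time
  bound pays for the final failing test.\<close>

lemma wp_While:
  assumes "I i s" and "i \<le> B"
    and "\<And>i s t. I i s \<Longrightarrow> bval b s \<Longrightarrow>
           i < B \<and> wp p s t (\<lambda>s' t'. I (Suc i) s' \<and> t' \<le> t + T)"
  shows "wp (While b p) s t
    (\<lambda>s' t'. (\<exists>j\<le>B. I j s') \<and> \<not> bval b s' \<and> t' \<le> t + (Suc (B - i)) * (T + 1 + bcost b))"
  using assms(1,2)
proof (induction "B - i" arbitrary: i s t)
  case 0
  then have "\<not> bval b s" using assms(3) by fastforce
  from exec.WhileFalse[OF this, of p] 0 this show ?case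
    unfolding wp_def by (intro exI[of _ "1 + bcost b"] exI[of _ s]) auto
next
  case (Suc d)
  show ?case
  proof (cases "bval b s")
    case False
    with Suc.prems show ?thesis
      unfolding wp_def by (intro exI[of _ "1 + bcost b"] exI[of _ s]) (auto dest: exec.WhileFalse)
  next
    case True
    from assms(3)[OF Suc.prems(1) True, of 0]
    obtain t1 s1 where s1: "exec p s t1 s1" "I (Suc i) s1" "t1 \<le> T" and i: "i < B"
      unfolding wp_def by auto
    have d: "d = B - Suc i" using Suc.hyps(2) by simp
    from Suc.hyps(1)[OF d s1(2), of 0] i obtain t2 s2 where
      s2: "exec (While b p) s1 t2 s2" "\<exists>j\<le>B. I j s2" "\<not> bval b s2"
         "t2 \<le> Suc (B - Suc i) * (T + 1 + bcost b)"
      unfolding wp_def by auto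
    have "B - i = Suc (B - Suc i)" using i by simp
    then have "1 + bcost b + t1 + t2 \<le> Suc (B - i) * (T + 1 + bcost b)"
      using s2(4) s1(3) by simp
    with exec.WhileTrue[OF True s1(1) s2(1)] s2(2,3) show ?thesis
      unfolding wp_def by (intro exI[of _ "1 + bcost b + t1 + t2"] exI[of _ s2]) auto
  qed
qed

text \<open>The invariant is required after the increment of \<open>x\<close>, which is itself part
  of the state. Of the 16 units per round, 6 pay for the increment and 6 for the guard; the surplus
  absorbs the initial assignment.\<close>

lemma wp_For:
  assumes "I 0 (s(x := (s x)(0 := 0)))" and "s b 0 = n" and "x \<noteq> b"
    and "x \<notin> writes p" and "b \<notin> writes p"
    and "\<And>i s t. i < n \<Longrightarrow> I i s \<Longrightarrow> s x 0 = i \<Longrightarrow> s b 0 = n \<Longrightarrow>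
           wp p s t (\<lambda>s' t'. I (Suc i) (s'(x := (s' x)(0 := Suc i))) \<and> t' \<le> t + T)"
  shows "wp (For x b p) s t (\<lambda>s' t'. I n s' \<and> t' \<le> t + Suc n * (T + 16))"
proof -
  let ?I = "\<lambda>i s. I i s \<and> s x 0 = i \<and> i \<le> n \<and> s b 0 = n"
  let ?s = "s(x := (s x)(0 := 0))"
  let ?b = "Less (Var x) (Var b)"
  let ?t = "Suc (Suc (Suc t))"
  have *: "wp (While ?b (p;; x ::= Plus (Var x) (N 1))) ?s ?t
     (\<lambda>s' t'. (\<exists>j\<le>n. ?I j s') \<and> \<not> bval ?b s' \<and>
        t' \<le> ?t + Suc (n - 0) * (T + 6 + 1 + bcost ?b))"
  proof (rule wp_While)
    fix i s t assume I: "?I i s" and b: "bval ?b s"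
    then have i: "i < n" by simp
    have "wp p s t (\<lambda>s' t'. wp (x ::= Plus (Var x) (N 1)) s' t'
       (\<lambda>s' t'. ?I (Suc i) s' \<and> t' \<le> t + (T + 6)))"
      by (rule wp_conseq[OF assms(6)[OF i]]) (use I i assms(3-5) in auto)
    with i show "i < n \<and> wp (p;; x ::= Plus (Var x) (N 1)) s t
       (\<lambda>s' t'. ?I (Suc i) s' \<and> t' \<le> t + (T + 6))" by simp
  qed (use assms(1-3) in auto)
  have "wp (While ?b (p;; x ::= Plus (Var x) (N 1))) ?s ?t
     (\<lambda>s' t'. I n s' \<and> t' \<le> t + Suc n * (T + 16))"
    by (rule wp_conseq[OF *]) (auto simp: algebra_simps)
  then show ?thesis by (simp add: For_def)
qed

section \<open>Enumeration of digit vectors\<close>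

definition val :: "nat \<Rightarrow> nat \<Rightarrow> (nat \<Rightarrow> nat) \<Rightarrow> nat" where
  "val b K x = (\<Sum>j<K. x j * b ^ j)"

lemma val_Suc [simp]: "val b (Suc K) x = val b K x + x K * b ^ K"
  by (simp add: val_def)

lemma val_0 [simp]: "val b 0 x = 0"
  by (simp add: val_def)

lemma val_upd: "i < K \<Longrightarrow> val b K (x(i := d)) + x i * b ^ i = val b K x + d * b ^ i"
proof -
  assume "i < K"
  then have i: "i \<in> {..<K}" by simp
  show ?thesis unfolding val_def
    by (subst (1 2) sum.remove[OF _ i]) (auto intro!: sum.cong)
qed

lemma val_less: "(\<And>j. j < K \<Longrightarrow> x j < b) \<Longrightarrow> val b K x < b ^ K"
proof (induction K)
  case (Suc K)
  then have "val b K x < b ^ K" "Suc (x K) \<le> b" by (simp_all add: Suc_leI)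
  moreover from this(2) have "Suc (x K) * b ^ K \<le> b * b ^ K" by (rule mult_le_mono1)
  ultimately show ?case by simp
qed simp

lemma val_inj:
  "(\<And>j. j < K \<Longrightarrow> x j < b) \<Longrightarrow> (\<And>j. j < K \<Longrightarrow> y j < b) \<Longrightarrow> val b K x = val b K y \<Longrightarrow> j < K \<Longrightarrow> x j = y j"
proof (induction K)
  case (Suc K)
  have x: "val b K x < b ^ K" and y: "val b K y < b ^ K"
    using Suc.prems(1,2) by (auto intro!: val_less)
  have "(val b K x + x K * b ^ K) div b ^ K = (val b K y + y K * b ^ K) div b ^ K"
    using Suc.prems(3) by simp
  moreover have "b ^ K > 0" using x by (cases "b ^ K") auto
  ultimately have "x K = y K" using x y by simp
  with Suc show ?case by (auto simp: less_Suc_eq)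
qed simp

lemma val_eq_0: "val b K x = 0 \<Longrightarrow> 0 < b \<Longrightarrow> j < K \<Longrightarrow> x j = 0"
  by (auto simp: val_def)

text \<open>Position of \<open>x\<close> in the enumeration of all digit vectors by length and then by value.\<close>

definition pos :: "nat \<Rightarrow> nat \<Rightarrow> (nat \<Rightarrow> nat) \<Rightarrow> nat" where
  "pos b K x = (\<Sum>j<K. b ^ j) + val b K x"

text \<open>All shorter vectors together are fewer than those of length \<open>K\<close>. This is
  why trying the lengths one after another costs only a factor of 2.\<close>

lemma sum_powers_less: "2 \<le> b \<Longrightarrow> (\<Sum>j<K. b ^ j) < (b :: nat) ^ K"
proof (induction K)
  case (Suc K)
  have "2 * b ^ K \<le> b * b ^ K" using Suc.prems by simp
  moreover have "(\<Sum>j<K. b ^ j) < b ^ K" using Suc by simp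
  ultimately show ?case by (simp only: power_Suc sum.lessThan_Suc)
qed simp

lemma pos_less:
  assumes "\<And>j. j < K \<Longrightarrow> x j < b" and "2 \<le> b"
  shows "pos b K x < 2 * b ^ K"
  using val_less[of K x b, OF assms(1)] sum_powers_less[OF assms(2), of K]
  by (simp add: pos_def)

lemma pos_less_Suc: "(\<And>j. j < K \<Longrightarrow> x j < b) \<Longrightarrow> pos b K x < (\<Sum>j<Suc K. b ^ j)"
  using val_less[of K x b] by (simp add: pos_def)

text \<open>Vectors of length \<open>K\<close> occupy the positions from
  \<open>\<Sum>j<K. b ^ j\<close> up to, but excluding, the same sum for \<open>Suc K\<close>; these
  intervals are disjoint.\<close>

lemma pos_inj:
  assumes "\<And>j. j < K \<Longrightarrow> x j < b" "\<And>j. j < K' \<Longrightarrow> y j < b" and "pos b K x = pos b K' y"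
  shows "K = K'"
proof -
  have *: "pos b K x < pos b K' y"
    if "K < K'" "\<And>j. j < K \<Longrightarrow> x j < b" for K K' x y
  proof -
    have "pos b K x < (\<Sum>j<Suc K. b ^ j)" using val_less[OF that(2)] by (simp add: pos_def)
    also have "\<dots> \<le> (\<Sum>j<K'. b ^ j)" using that(1) by (intro sum_mono2) auto
    finally show ?thesis by (simp add: pos_def)
  qed
  show ?thesis
    using *[of K K' x y] *[of K' K y x] assms by (cases K K' rule: linorder_cases) auto
qed

section \<open>Greedy covers\<close>

text \<open>The digit consulted is the one at the current length of the cover, so only conflicts
  that are still uncovered use up digits. Every nonzero digit selects \<open>f\<close>, which makes
  vectors over any larger alphabet usable.\<close>

definition pick :: "(nat \<Rightarrow> nat) \<Rightarrow> 'a \<times> 'a \<Rightarrow> 'a list \<Rightarrow> 'a list" where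
  "pick x p cov = (case p of (e, f) \<Rightarrow>
     if e \<in> set cov \<or> f \<in> set cov then cov
     else cov @ [if x (length cov) = 0 then e else f])"

lemma pick_mono: "set cov \<subseteq> set (fold (pick x) ps cov)"
proof (induction ps arbitrary: cov)
  case (Cons p ps)
  have "set cov \<subseteq> set (pick x p cov)" by (cases p) (auto simp: pick_def)
  with Cons show ?case by fastforce
qed simp

lemma pick_covers:
  "(e, f) \<in> set ps \<Longrightarrow> e \<in> set (fold (pick x) ps cov) \<or> f \<in> set (fold (pick x) ps cov)"
proof (induction ps arbitrary: cov)
  case (Cons p ps)
  show ?case
  proof (cases "p = (e, f)")
    case True
    then have "e \<in> set (pick x p cov) \<or> f \<in> set (pick x p cov)" by (simp add: pick_def)
    with pick_mono[of "pick x p cov" x ps] show ?thesis by auto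
  qed (use Cons in auto)
qed simp

lemma pick_distinct: "distinct cov \<Longrightarrow> distinct (fold (pick x) ps cov)"
proof (induction ps arbitrary: cov)
  case (Cons p ps)
  then have "distinct (pick x p cov)" by (auto simp: pick_def split: prod.split)
  with Cons show ?case by simp
qed simp

lemma pick_subset:
  "set cov \<subseteq> A \<Longrightarrow> set ps \<subseteq> A \<times> A \<Longrightarrow> set (fold (pick x) ps cov) \<subseteq> A"
proof (induction ps arbitrary: cov)
  case (Cons p ps)
  then have "set (pick x p cov) \<subseteq> A" by (auto simp: pick_def split: prod.split)
  with Cons show ?case by simp
qed simp

lemma pick_cong:
  "(\<And>i. length cov \<le> i \<Longrightarrow> x i = y i) \<Longrightarrow> fold (pick x) ps cov = fold (pick y) ps cov"
proof (induction ps arbitrary: cov)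
  case (Cons p ps)
  have "pick x p cov = pick y p cov" using Cons.prems by (auto simp: pick_def split: prod.split)
  moreover have "length cov \<le> length (pick y p cov)" by (auto simp: pick_def split: prod.split)
  ultimately show ?case using Cons by simp
qed simp

text \<open>The vector is read off from \<open>C\<close>: an uncovered conflict is settled by
  whichever of \<open>e\<close> and \<open>f\<close> lies in \<open>C\<close>. Each choice is a new
  element of \<open>C\<close>, so no more than \<open>card C\<close> digits are consumed.\<close>

lemma pick_guided:
  assumes "finite C" and "\<forall>(e, f)\<in>set ps. e \<in> C \<or> f \<in> C" and "distinct cov" "set cov \<subseteq> C"
  shows "\<exists>x. (\<forall>i. x i \<le> 1) \<and> (\<forall>i\<ge>card C. x i = (0 :: nat)) \<and> set (fold (pick x) ps cov) \<subseteq> C"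
  using assms(2-4)
proof (induction ps arbitrary: cov)
  case Nil
  then show ?case by (auto intro: exI[of _ "\<lambda>_. 0"])
next
  case (Cons p ps)
  obtain e f where p: "p = (e, f)" by (cases p)
  show ?case
  proof (cases "e \<in> set cov \<or> f \<in> set cov")
    case True
    with Cons p show ?thesis by (auto simp: pick_def)
  next
    case False
    let ?d = "if e \<in> C then 0 else 1 :: nat"
    let ?z = "if e \<in> C then e else f"
    have z: "?z \<in> C" "?z \<notin> set cov" using Cons.prems False p by auto
    then have "set (cov @ [?z]) \<subseteq> C" "distinct (cov @ [?z])" using Cons.prems by auto
    with Cons.IH[of "cov @ [?z]"] Cons.prems obtain x where x: "\<forall>i. x i \<le> 1"
      "\<forall>i\<ge>card C. x i = (0 :: nat)" "set (fold (pick x) ps (cov @ [?z])) \<subseteq> C" by auto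
    have "length cov = card (set cov)" using Cons.prems by (simp add: distinct_card)
    also have "\<dots> < card C" using z Cons.prems by (intro psubset_card_mono assms(1)) auto
    finally have len: "length cov < card C" .
    \<comment> \<open>Overwriting this digit of the vector from the induction hypothesis is
      harmless: the rest of the fold starts with a longer cover and reads only later digits.\<close>
    let ?x = "x(length cov := ?d)"
    have "pick ?x p cov = cov @ [?z]" using False p by (auto simp: pick_def)
    moreover have "fold (pick ?x) ps (cov @ [?z]) = fold (pick x) ps (cov @ [?z])"
      by (rule pick_cong) simp
    ultimately have "set (fold (pick ?x) (p # ps) cov) \<subseteq> C" using x(3) by simp
    moreover have "\<forall>i. ?x i \<le> 1" "\<forall>i\<ge>card C. ?x i = 0" using x(1,2) len by auto
    ultimately show ?thesis by blast
  qed
qed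

section \<open>The conflict graph\<close>

locale multi_stc =
  fixes n c k :: nat and E :: "nat set set" and \<Psi> :: "nat set \<Rightarrow> nat set"
    and es :: "(nat \<times> nat) list"
  assumes graph: "simple_graph {..<n} E" and lists: "\<forall>e\<in>E. \<Psi> e \<subseteq> {1..c}"
    and edges: "lists_edges es E"
begin

abbreviation m :: nat where "m \<equiv> length es"

definition ed :: "nat \<Rightarrow> nat set" where "ed i = {fst (es ! i), snd (es ! i)}"

lemma map_ed: "map ed [0..<m] = map (\<lambda>(u, v). {u, v}) es"
  by (rule nth_equalityI) (auto simp: ed_def split: prod.split)

lemma ed_inj: "inj_on ed {..<m}"
  using edges unfolding lists_edges_def map_ed[symmetric] distinct_map
  by (auto simp: atLeast0LessThan)

lemma ed_image: "ed ` {..<m} = E"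
proof -
  have "set (map ed [0..<m]) = E" using edges unfolding lists_edges_def map_ed by simp
  then show ?thesis by (simp add: atLeast0LessThan)
qed

lemma ed_bij: "bij_betw ed {..<m} E"
  using ed_inj ed_image by (simp add: bij_betw_def)

lemma card_E: "card E = m"
  using bij_betw_same_card[OF ed_bij] by simp

lemma ed_in: "i < m \<Longrightarrow> ed i \<in> E"
  using ed_image by auto

lemma ed_eq: "i < m \<Longrightarrow> j < m \<Longrightarrow> ed i = ed j \<longleftrightarrow> i = j"
  using ed_inj by (auto simp: inj_on_def)

lemma edE: assumes "e \<in> E" obtains i where "i < m" "e = ed i"
  using assms ed_image by auto

lemma edge_lt: "{a, b} \<in> E \<Longrightarrow> a < n \<and> b < n \<and> a \<noteq> b"
  using graph unfolding simple_graph_def by fastforce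

lemma finite_E: "finite E"
  by (simp flip: ed_image)

definition conf :: "nat \<Rightarrow> nat \<Rightarrow> bool" where
  "conf i j \<longleftrightarrow> i < m \<and> j < m \<and>
     (\<exists>a b d. a \<noteq> d \<and> ed i = {a, b} \<and> ed j = {b, d} \<and> {a, d} \<notin> E)"

lemma conf_sym: "conf i j \<Longrightarrow> conf j i"
  unfolding conf_def
proof (elim conjE exE)
  fix a b d assume *: "i < m" "j < m" "a \<noteq> d" "ed i = {a, b}" "ed j = {b, d}" "{a, d} \<notin> E"
  then have "d \<noteq> a" "ed j = {d, b}" "ed i = {b, a}" "{d, a} \<notin> E" by (auto simp: insert_commute)
  with * show "j < m \<and> i < m \<and> (\<exists>a b d. a \<noteq> d \<and> ed j = {a, b} \<and> ed i = {b, d} \<and> {a, d} \<notin> E)"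
    by blast
qed

text \<open>The shift by one frees 0, the content of an untouched memory cell, for non-adjacency.
  Storing the edge number instead of a bit yields the conflicting edge itself.\<close>

definition adjn :: "nat \<Rightarrow> nat \<Rightarrow> nat" where
  "adjn a b = (if {a, b} \<in> E then Suc (THE j. j < m \<and> ed j = {a, b}) else 0)"

lemma adjn_eq_Suc: "adjn a b = Suc j \<longleftrightarrow> j < m \<and> ed j = {a, b}"
proof (cases "{a, b} \<in> E")
  case True
  then obtain i where i: "i < m" "{a, b} = ed i" by (rule edE)
  then have "(THE j. j < m \<and> ed j = {a, b}) = i" by (intro the_equality) (auto simp: ed_eq)
  with i True show ?thesis by (auto simp: adjn_def ed_eq)
qed (auto simp: adjn_def dest: ed_in)

lemma adjn_eq_0: "adjn a b = 0 \<longleftrightarrow> {a, b} \<notin> E"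
  by (simp add: adjn_def)

text \<open>Exactly one of the two end points of \<open>e\<close> is adjacent to \<open>w\<close> if \<open>e\<close> is in conflict with the
  edge to \<open>w\<close>, or if \<open>w\<close> is itself an end point of \<open>e\<close>.\<close>

definition cfl :: "nat \<Rightarrow> nat \<Rightarrow> nat" where
  "cfl e w = (let f = adjn (fst (es ! e)) w; g = adjn (snd (es ! e)) w in
     if 0 < f \<and> 0 < g \<or> f + g = Suc e then 0 else f + g)"

text \<open>A conflict consists of \<open>e\<close> and an edge from one of its ends to a third
  vertex \<open>w\<close> that is not adjacent to the other end. Hence the \<open>m * n\<close>
  pairs of an edge and a vertex reach all conflicts.\<close>

lemma cfl_iff:
  assumes e: "e < m"
  shows "(\<exists>w<n. cfl e w = Suc f) \<longleftrightarrow> conf e f"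
proof
  let ?u = "fst (es ! e)" and ?v = "snd (es ! e)"
  assume "\<exists>w<n. cfl e w = Suc f"
  then obtain w where w: "cfl e w = Suc f" by blast
  then have fe: "f \<noteq> e" and
    "adjn ?u w = Suc f \<and> adjn ?v w = 0 \<or> adjn ?v w = Suc f \<and> adjn ?u w = 0"
    by (auto simp: cfl_def Let_def split: if_splits)
  then obtain p q where pq: "ed e = {p, q}" "adjn q w = Suc f" "adjn p w = 0"
    by (auto simp: ed_def)
  then have f: "f < m" "ed f = {q, w}" "{p, w} \<notin> E" by (auto simp: adjn_eq_Suc adjn_eq_0)
  \<comment> \<open>Otherwise edge \<open>f\<close> would be \<open>{q, p}\<close>, that is,
    \<open>e\<close> itself.\<close>
  have "p \<noteq> w" using fe f pq(1) e by (auto simp: insert_commute simp flip: ed_eq)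
  with f pq(1) e show "conf e f" unfolding conf_def by blast
next
  let ?u = "fst (es ! e)" and ?v = "snd (es ! e)"
  assume "conf e f"
  then obtain p q w where f: "f < m" "p \<noteq> w" "ed e = {p, q}" "ed f = {q, w}" "{p, w} \<notin> E"
    unfolding conf_def by blast
  have "w < n" using ed_in[OF f(1)] f(4) edge_lt by auto
  moreover have "f \<noteq> e" using f edge_lt[of p q] ed_in[OF e] by (auto simp: doubleton_eq_iff)
  moreover have "adjn q w = Suc f" "adjn p w = 0" using f by (auto simp: adjn_eq_Suc adjn_eq_0)
  moreover have "?u = p \<and> ?v = q \<or> ?u = q \<and> ?v = p"
    using f(3) by (auto simp: ed_def doubleton_eq_iff)
  ultimately show "\<exists>w<n. cfl e w = Suc f"
    by (intro exI[of _ w]) (auto simp: cfl_def Let_def)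
qed

section \<open>Covers of the conflict graph, and labelings induced by coloring a cover\<close>

definition cover :: "nat set \<Rightarrow> bool" where
  "cover C \<longleftrightarrow> C \<subseteq> {..<m} \<and> (\<forall>i j. conf i j \<longrightarrow> i \<in> C \<or> j \<in> C)"

text \<open>The minimum that defines \<open>k1\<close> is attained: labeling every edge weak shows
  that the set is nonempty, and \<open>card E\<close> bounds it. A minimizer supplies the
  cover.\<close>

lemma ex_cover_k1: "\<exists>C. cover C \<and> card C = k1 E"
proof -
  let ?S = "{card (weak L) | L. stc_labeling E 1 L}"
  have "stc_labeling E 1 (Labeling (\<lambda>_. {}) E)"
    by (auto simp: stc_labeling_def c_labeling_def disjoint_family_on_def)
  then have "?S \<noteq> {}" by blast
  moreover have "?S \<subseteq> {..card E}"
    using finite_E by (auto simp: stc_labeling_def c_labeling_def intro!: card_mono)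
  then have "finite ?S" by (rule finite_subset) simp
  ultimately have "k1 E \<in> ?S" unfolding k1_def by (intro Min_in)
  then obtain L where L: "stc_labeling E 1 L" "card (weak L) = k1 E" by auto
  let ?C = "{i. i < m \<and> ed i \<in> weak L}"
  have E: "strong L 1 \<union> weak L = E" using L(1) by (simp add: stc_labeling_def c_labeling_def)
  have "x \<in> ed ` ?C" if "x \<in> weak L" for x
    using E that edE[of x] by blast
  then have "ed ` ?C = weak L" by auto
  moreover have "inj_on ed ?C" using ed_inj by (rule inj_on_subset) auto
  ultimately have "card ?C = k1 E" using L(2) card_image by fastforce
  moreover have "cover ?C"
    unfolding cover_def
  proof (intro conjI allI impI)
    fix i j assume "conf i j"
    then obtain a b d where *: "i < m" "j < m" "a \<noteq> d" "ed i = {a, b}" "ed j = {b, d}" "{a, d} \<notin> E"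
      unfolding conf_def by blast
    have "\<not> (ed i \<in> strong L 1 \<and> ed j \<in> strong L 1)"
      using L(1) *(3,6) unfolding stc_labeling_def *(4,5) by auto
    then show "i \<in> ?C \<or> j \<in> ?C" using E ed_in[OF *(1)] ed_in[OF *(2)] *(1,2) by auto
  qed auto
  ultimately show ?thesis by blast
qed

text \<open>An edge of \<open>C\<close> whose color is forbidden or clashes counts as weak, so that every \<open>\<phi>\<close> yields a
  valid labeling.\<close>

definition weak_edges :: "nat set \<Rightarrow> (nat \<Rightarrow> nat) \<Rightarrow> nat set" where
  "weak_edges C \<phi> = {e. e < m \<and> \<not> (\<exists>\<alpha>\<in>\<Psi> (ed e).
     (\<forall>f\<in>C. conf e f \<longrightarrow> \<phi> f \<noteq> \<alpha>) \<and> (e \<in> C \<longrightarrow> \<phi> e = \<alpha>))}"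

text \<open>Every edge outside \<open>weak_edges C \<phi>\<close> takes some color that passes the
  test. Two conflicting edges cannot end up with the same color: one of them, say \<open>f\<close>,
  lies in \<open>C\<close> and has color \<open>\<phi> f\<close>, which the other one had to
  avoid.\<close>

lemma el_multi_stc_if_weak_edges:
  assumes C: "cover C" and k: "card (weak_edges C \<phi>) \<le> k"
  shows "el_multi_stc E c k \<Psi>"
proof -
  define ok where "ok e \<alpha> \<longleftrightarrow> \<alpha> \<in> \<Psi> (ed e) \<and>
     (\<forall>f\<in>C. conf e f \<longrightarrow> \<phi> f \<noteq> \<alpha>) \<and> (e \<in> C \<longrightarrow> \<phi> e = \<alpha>)" for e \<alpha>
  define col where "col e = (SOME \<alpha>. ok e \<alpha>)" for e
  let ?W = "weak_edges C \<phi>"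
  have W: "?W = {e. e < m \<and> \<not> (\<exists>\<alpha>. ok e \<alpha>)}" by (auto simp: weak_edges_def ok_def)
  define L where "L = Labeling (\<lambda>\<alpha>. ed ` {e. e < m \<and> e \<notin> ?W \<and> col e = \<alpha>}) (ed ` ?W)"
  have ok: "ok e (col e)" if "e < m" "e \<notin> ?W" for e
    using that unfolding W col_def by (auto intro: someI)
  have in_strong: "ed e \<in> strong L \<alpha> \<longleftrightarrow> e \<notin> ?W \<and> col e = \<alpha>" if "e < m" for e \<alpha>
    using that ed_inj by (auto simp: L_def inj_on_def)
  have in_weak: "ed e \<in> weak L \<longleftrightarrow> e \<in> ?W" if "e < m" for e
    using that ed_inj by (auto simp: L_def inj_on_def weak_edges_def)
  have sub: "strong L \<alpha> \<subseteq> E" "weak L \<subseteq> E" for \<alpha>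
    using ed_in by (auto simp: L_def weak_edges_def)
  have range: "col e \<in> {1..c}" if "e < m" "e \<notin> ?W" for e
    using ok[OF that] lists ed_in[OF that(1)] unfolding ok_def by blast
  have "c_labeling E c L"
    unfolding c_labeling_def
  proof (intro conjI ballI)
    show "(\<Union>i\<in>{1..c}. strong L i) \<union> weak L = E"
    proof (intro equalityI subsetI)
      fix e assume "e \<in> E"
      then obtain i where i: "i < m" "e = ed i" by (rule edE)
      show "e \<in> (\<Union>i\<in>{1..c}. strong L i) \<union> weak L"
        using in_strong[OF i(1)] in_weak[OF i(1)] range[OF i(1)] i(2) by (cases "i \<in> ?W") auto
    qed (use sub in blast)
    \<comment> \<open>Disjointness is checked on edge numbers, where \<open>in_strong\<close> and
      \<open>in_weak\<close> apply.\<close>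
    have dis: "strong L i \<inter> X = {}" if "\<And>e. e < m \<Longrightarrow> ed e \<in> strong L i \<Longrightarrow> ed e \<notin> X" for i X
    proof (rule ccontr)
      assume "\<not> ?thesis"
      then obtain x where x: "x \<in> strong L i" "x \<in> X" by blast
      with sub(1) obtain e where "e < m" "x = ed e" by (meson edE subsetD)
      with that x show False by blast
    qed
    show "disjoint_family_on (strong L) {1..c}"
      unfolding disjoint_family_on_def by (auto intro!: dis simp: in_strong)
    show "strong L i \<inter> weak L = {}" for i
      by (rule dis) (simp add: in_strong in_weak)
  qed
  moreover have False
    if uw: "u \<noteq> w" "{u, v} \<in> strong L i" "{v, w} \<in> strong L i" "{u, w} \<notin> E" for i u v w
  proof -
    obtain e f where ef: "e < m" "{u, v} = ed e" "f < m" "{v, w} = ed f"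
      using sub(1)[of i] uw(2,3) by (meson edE subsetD)
    have con: "conf e f" using ef(1,3) uw(1,4) unfolding conf_def ef(2,4)[symmetric] by blast
    note con = con conf_sym[OF con]
    have "ok e i" "ok f i"
      using uw(2,3) ok[OF ef(1)] ok[OF ef(3)] in_strong[OF ef(1), of i] in_strong[OF ef(3), of i]
      unfolding ef(2,4) by metis+
    moreover have "e \<in> C \<or> f \<in> C" using C con(1) unfolding cover_def by blast
    ultimately show False using con unfolding ok_def by metis
  qed
  ultimately have "stc_labeling E c L" unfolding stc_labeling_def by metis
  moreover have "psi_satisfying E \<Psi> L"
    unfolding psi_satisfying_def
  proof
    fix e assume "e \<in> E"
    then obtain i where i: "i < m" "e = ed i" by (rule edE)
    then show "e \<in> weak L \<or> (\<exists>\<alpha>\<in>\<Psi> e. e \<in> strong L \<alpha>)"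
      using ok[OF i(1)] in_weak[OF i(1)] in_strong[OF i(1)] unfolding ok_def i(2) by metis
  qed
  moreover have "card (weak L) \<le> k"
  proof -
    have "finite ?W" unfolding weak_edges_def by simp
    then have "card (weak L) \<le> card ?W" unfolding L_def by (simp add: card_image_le)
    with k show ?thesis by simp
  qed
  ultimately show ?thesis unfolding el_multi_stc_def by blast
qed

text \<open>Here \<open>\<phi>\<close> copies the colors of a solution \<open>L\<close>, with 0,
  which is no color, for weak edges. A strong edge of \<open>L\<close> passes the test with its own
  color, since no conflicting edge has that color; so only weak edges of \<open>L\<close> are
  counted.\<close>

lemma weak_edges_if_el_multi_stc:
  assumes "el_multi_stc E c k \<Psi>"
  shows "\<exists>\<phi>. (\<forall>e. \<phi> e \<le> c) \<and> card (weak_edges C (\<lambda>e. if e \<in> C then \<phi> e else 0)) \<le> k"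
proof -
  obtain L where L: "stc_labeling E c L" "psi_satisfying E \<Psi> L" "card (weak L) \<le> k"
    using assms unfolding el_multi_stc_def by blast
  have cl: "c_labeling E c L" using L(1) by (simp add: stc_labeling_def)
  define P where "P e \<alpha> \<longleftrightarrow> \<alpha> \<in> {1..c} \<and> ed e \<in> strong L \<alpha>" for e \<alpha>
  define \<phi> where "\<phi> e = (if \<exists>\<alpha>. P e \<alpha> then SOME \<alpha>. P e \<alpha> else 0)" for e
  have some: "\<phi> e \<in> {1..c} \<and> ed e \<in> strong L (\<phi> e)"
    if "\<exists>\<alpha>. \<alpha> \<in> {1..c} \<and> ed e \<in> strong L \<alpha>" for e
    using someI_ex[of "P e"] that unfolding \<phi>_def P_def[symmetric] by simp
  have phi: "\<phi> e = 0 \<or> \<phi> e \<in> {1..c} \<and> ed e \<in> strong L (\<phi> e)" for e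
    using some[of e] unfolding \<phi>_def P_def by presburger
  \<comment> \<open>The strong classes are disjoint, so the color chosen by \<open>SOME\<close> is
    forced.\<close>
  have phi_eq: "\<phi> e = \<alpha>" if "\<alpha> \<in> {1..c}" "ed e \<in> strong L \<alpha>" for e \<alpha>
  proof (rule ccontr)
    assume ne: "\<phi> e \<noteq> \<alpha>"
    have "\<phi> e \<in> {1..c}" "ed e \<in> strong L (\<phi> e)" using some that by blast+
    with ne that have "strong L (\<phi> e) \<inter> strong L \<alpha> = {}"
      using cl unfolding c_labeling_def by (auto dest: disjoint_family_onD)
    with that(2) \<open>ed e \<in> strong L (\<phi> e)\<close> show False by blast
  qed
  have "weak_edges C (\<lambda>e. if e \<in> C then \<phi> e else 0) \<subseteq> {e. e < m \<and> ed e \<in> weak L}"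
  proof
    fix e assume e: "e \<in> weak_edges C (\<lambda>e. if e \<in> C then \<phi> e else 0)"
    then have em: "e < m" by (simp add: weak_edges_def)
    show "e \<in> {e. e < m \<and> ed e \<in> weak L}"
    proof (rule ccontr)
      assume "\<not> ?thesis"
      with em L(2) ed_in obtain \<alpha> where a: "\<alpha> \<in> \<Psi> (ed e)" "ed e \<in> strong L \<alpha>"
        unfolding psi_satisfying_def by blast
      then have ac: "\<alpha> \<in> {1..c}" using lists ed_in[OF em] by blast
      have "\<phi> f \<noteq> \<alpha>" if ef: "conf e f" for f
      proof
        assume "\<phi> f = \<alpha>"
        then have "\<phi> f \<noteq> 0" using ac by simp
        with phi[of f] \<open>\<phi> f = \<alpha>\<close> have "ed f \<in> strong L \<alpha>" by blast
        obtain p q r where *: "p \<noteq> r" "ed e = {p, q}" "ed f = {q, r}" "{p, r} \<notin> E"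
          using ef unfolding conf_def by blast
        have "{p, q} \<in> strong L \<alpha>" "{q, r} \<in> strong L \<alpha>"
          using a(2) \<open>ed f \<in> strong L \<alpha>\<close> *(2,3) by simp_all
        with *(1,4) ac L(1) show False unfolding stc_labeling_def by blast
      qed
      with a(1) ac phi_eq[OF ac a(2)] have "e \<notin> weak_edges C (\<lambda>e. if e \<in> C then \<phi> e else 0)"
        unfolding weak_edges_def by (simp only: mem_Collect_eq, intro notI, elim conjE notE, intro bexI[of _ \<alpha>]) simp_all
      with e show False by contradiction
    qed
  qed
  moreover have finite_m: "finite {e. e < m \<and> ed e \<in> weak L}" by simp
  moreover have "card {e. e < m \<and> ed e \<in> weak L} \<le> card (weak L)"
  proof (rule card_inj_on_le)
    show "inj_on ed {e. e < m \<and> ed e \<in> weak L}" using ed_inj by (rule inj_on_subset) auto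
    have "weak L \<subseteq> E" using cl unfolding c_labeling_def by blast
    then show "finite (weak L)" using finite_E by (rule finite_subset)
  qed auto
  ultimately have "card (weak_edges C (\<lambda>e. if e \<in> C then \<phi> e else 0)) \<le> card (weak L)"
    using card_mono[of "{e. e < m \<and> ed e \<in> weak L}"] by (metis (lifting) finite_m order_trans)
  moreover have "\<phi> e \<le> c" for e using phi[of e] by auto
  ultimately show ?thesis using L(3) by (intro exI[of _ \<phi>]) auto
qed

section \<open>Conflicts and covers in the order of the scan\<close>

definition conf_row :: "nat \<Rightarrow> nat \<Rightarrow> (nat \<times> nat) list" where
  "conf_row e w = concat (map (\<lambda>i. if cfl e i = 0 then [] else [(e, cfl e i - 1)]) [0..<w])"

definition conf_upto :: "nat \<Rightarrow> nat \<Rightarrow> (nat \<times> nat) list" where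
  "conf_upto e w = concat (map (\<lambda>i. conf_row i n) [0..<e]) @ conf_row e w"

lemma conf_upto_0 [simp]: "conf_upto 0 0 = []"
  by (simp add: conf_upto_def conf_row_def)

lemma conf_upto_Suc:
  "conf_upto e (Suc w) = conf_upto e w @ (if cfl e w = 0 then [] else [(e, cfl e w - 1)])"
  by (simp add: conf_upto_def conf_row_def)

lemma conf_upto_n: "conf_upto e n = conf_upto (Suc e) 0"
  by (simp add: conf_upto_def conf_row_def)

lemma set_conf_row: "e < m \<Longrightarrow> set (conf_row e n) = {(e, f) | f. conf e f}"
proof -
  assume "e < m"
  have "set (conf_row e n) = {(e, f) | f. \<exists>w<n. cfl e w = Suc f}"
    unfolding conf_row_def
    by (auto simp: image_iff split: if_splits)
  with cfl_iff[OF \<open>e < m\<close>] show ?thesis by simp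
qed

lemma set_conf_upto: "set (conf_upto m 0) = {(e, f). conf e f}"
proof -
  have "set (conf_upto m 0) = (\<Union>e<m. set (conf_row e n))"
    by (auto simp: conf_upto_def conf_row_def)
  also have "\<dots> = {(e, f). conf e f}" by (auto simp: set_conf_row) (auto simp: conf_def)
  finally show ?thesis .
qed

definition cov_upto :: "(nat \<Rightarrow> nat) \<Rightarrow> nat \<Rightarrow> nat \<Rightarrow> nat list" where
  "cov_upto x e w = fold (pick x) (conf_upto e w) []"

text \<open>These are the steps of two nested loops standing at edge \<open>e\<close> and vertex
  \<open>w\<close>: the start, one round of the inner loop, and the passage to the next edge. They
  carry the loop invariant of the scan.\<close>

lemma cov_upto_simps:
  "cov_upto x 0 0 = []"
  "cov_upto x e (Suc w) = (if cfl e w = 0 then cov_upto x e w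
     else pick x (e, cfl e w - 1) (cov_upto x e w))"
  "cov_upto x e n = cov_upto x (Suc e) 0"
  by (simp_all add: cov_upto_def conf_upto_Suc conf_upto_n)

abbreviation covl :: "(nat \<Rightarrow> nat) \<Rightarrow> nat list" where "covl x \<equiv> cov_upto x m 0"

lemma cover_covl: "cover (set (covl x))"
proof -
  have "set (conf_upto m 0) \<subseteq> {..<m} \<times> {..<m}" by (auto simp: set_conf_upto conf_def)
  then have "set (covl x) \<subseteq> {..<m}" unfolding cov_upto_def by (intro pick_subset) auto
  then show ?thesis
    using pick_covers[of _ _ "conf_upto m 0" x "[]"] by (auto simp: cover_def set_conf_upto cov_upto_def)
qed

lemma distinct_cov_upto: "distinct (cov_upto x e w)"
  unfolding cov_upto_def by (rule pick_distinct) simp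

text \<open>Termination of the search rests on this vector: a cover of size \<open>k1 E\<close>
  guides the scan, and the result stays inside that cover.\<close>

lemma ex_covl_short:
  "\<exists>x. (\<forall>i. x i \<le> 1) \<and> (\<forall>i\<ge>k1 E. x i = 0) \<and> length (covl x) \<le> k1 E"
proof -
  obtain C where C: "cover C" "card C = k1 E" using ex_cover_k1 by blast
  then have fin: "finite C" by (auto simp: cover_def intro: finite_subset)
  from pick_guided[OF fin, of "conf_upto m 0" "[]"] C
  obtain x where x: "\<forall>i. x i \<le> 1" "\<forall>i\<ge>k1 E. x i = (0::nat)" "set (covl x) \<subseteq> C"
    by (auto simp: cover_def set_conf_upto cov_upto_def)
  have "length (covl x) = card (set (covl x))" by (simp add: distinct_card distinct_cov_upto)
  also have "\<dots> \<le> k1 E" using x(3) C(2) card_mono[OF fin] by metis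
  finally show ?thesis using x by blast
qed

lemma k1_le: "k1 E \<le> m"
proof -
  obtain C where "C \<subseteq> {..<m}" "card C = k1 E" using ex_cover_k1 unfolding cover_def by blast
  then show ?thesis using card_mono[of "{..<m}" C] by simp
qed

end

section \<open>Programs for the search of a small cover\<close>

text \<open>Leaves \<open>cfl e w\<close> in \<open>f\<close>. Row addresses of the adjacency table
  come from \<open>off\<close>, since the machine cannot multiply.\<close>

definition conf_com :: com where
  "conf_com =
     ''f'' ::= Rd ''adj'' (Plus (Rd ''off'' (Rd ''u'' (Var ''e''))) (Var ''w''));;
     ''g'' ::= Rd ''adj'' (Plus (Rd ''off'' (Rd ''v'' (Var ''e''))) (Var ''w''));;
     If (And (Less (N 0) (Var ''f'')) (Less (N 0) (Var ''g'')))
       (''f'' ::= N 0)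
       (''f'' ::= Plus (Var ''f'') (Var ''g'');;
        If (Eq (Var ''f'') (Plus (Var ''e'') (N 1))) (''f'' ::= N 0) Skip)"

text \<open>Edge \<open>z\<close> is in the current cover iff \<open>in[z] = it\<close>. With these stamps, starting a new scan does
  not require clearing \<open>in\<close>. Similarly, \<open>mark[\<alpha>] = st\<close> below means that color \<open>\<alpha>\<close> is used by a
  conflicting cover edge.\<close>

definition scan_step :: com where
  "scan_step =
     conf_com;;
     If (And (Less (N 0) (Var ''f''))
         (And (Not (Eq (Rd ''in'' (Var ''e'')) (Var ''it'')))
              (Not (Eq (Rd ''in'' (Minus (Var ''f'') (N 1))) (Var ''it'')))))
       (If (Eq (Rd ''x'' (Var ''J'')) (N 0))
          (''g'' ::= Var ''e'') (''g'' ::= Minus (Var ''f'') (N 1));;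
        Wr ''in'' (Var ''g'') (Var ''it'');;
        Wr ''cov'' (Var ''J'') (Var ''g'');;
        ''J'' ::= Plus (Var ''J'') (N 1))
       Skip"

definition scan :: com where
  "scan =
     ''it'' ::= Plus (Var ''it'') (N 1);;
     ''J'' ::= N 0;;
     For ''e'' ''m'' (For ''w'' ''n'' scan_step)"

text \<open>An odometer in base \<open>c + 1\<close> with the least significant digit first.
  \<open>ov\<close> reports that all digits were \<open>c\<close> and have been reset to 0.\<close>

definition inc :: "string \<Rightarrow> string \<Rightarrow> com" where
  "inc y l =
     ''i'' ::= N 0;;
     While (And (Less (Var ''i'') (Var l)) (Eq (Rd y (Var ''i'')) (Var ''c'')))
       (Wr y (Var ''i'') (N 0);; ''i'' ::= Plus (Var ''i'') (N 1));;
     If (Less (Var ''i'') (Var l))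
       (Wr y (Var ''i'') (Plus (Rd y (Var ''i'')) (N 1));; ''ov'' ::= N 0)
       (''ov'' ::= N 1)"

text \<open>The digits of \<open>x\<close> from index \<open>K\<close> on are 0. A scan may read them, but then its cover is longer
  than \<open>K\<close> and the scan counts as failed.\<close>

definition search :: com where
  "search =
     scan;;
     While (Less (Var ''K'') (Var ''J''))
       (inc ''x'' ''K'';;
        If (Eq (Var ''ov'') (N 1)) (''K'' ::= Plus (Var ''K'') (N 1)) Skip;;
        scan)"

lemma writes_scan [simp]: "writes scan = {''it'', ''J'', ''e'', ''w'', ''f'', ''g'', ''in'', ''cov''}"
  by (auto simp: scan_def scan_step_def conf_com_def)

lemma writes_inc [simp]: "writes (inc y l) = {''i'', y, ''ov''}"
  by (auto simp: inc_def)

lemma wp_inc: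
  assumes y: "y \<noteq> ''i''" "y \<noteq> ''c''" "y \<noteq> ''ov''" "y \<noteq> l" and l: "l \<noteq> ''i''" "l \<noteq> ''ov''"
    and s: "s ''c'' 0 = c" "s l 0 = K" "\<And>j. j < K \<Longrightarrow> s y j \<le> c"
  shows "wp (inc y l) s t (\<lambda>s' t'. (\<forall>j<K. s' y j \<le> c) \<and> (\<forall>j\<ge>K. s' y j = s y j) \<and>
     (if Suc (val (Suc c) K (s y)) < Suc c ^ K
      then s' ''ov'' 0 = 0 \<and> val (Suc c) K (s' y) = Suc (val (Suc c) K (s y))
      else s' ''ov'' 0 = 1 \<and> Suc (val (Suc c) K (s y)) = Suc c ^ K \<and> (\<forall>j<K. s' y j = 0)) \<and>
     t' \<le> t + 60 * Suc K)"
proof -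
  let ?b = "Suc c"
  let ?v = "val ?b K (s y)"
  \<comment> \<open>The \<open>i\<close> cleared digits were all \<open>c\<close> and amounted to
    \<open>?b ^ i - 1\<close>, so the pending carry is worth \<open>?b ^ i\<close>.\<close>
  let ?I = "\<lambda>i s'. s' ''i'' 0 = i \<and> i \<le> K \<and> s' ''c'' 0 = c \<and> s' l 0 = K \<and>
    (\<forall>j<K. s' y j \<le> c) \<and> (\<forall>j\<ge>K. s' y j = s y j) \<and> val ?b K (s' y) + ?b ^ i = Suc ?v"
  let ?g = "And (Less (Var ''i'') (Var l)) (Eq (Rd y (Var ''i'')) (Var ''c''))"
  let ?p = "Wr y (Var ''i'') (N 0);; ''i'' ::= Plus (Var ''i'') (N 1)"
  have v: "?v < ?b ^ K" using s(3) by (intro val_less) (simp add: less_Suc_eq_le)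
  have loop: "wp (While ?g ?p) s' t (\<lambda>s' t'. (\<exists>i\<le>K. ?I i s') \<and> \<not> bval ?g s' \<and>
       t' \<le> t + Suc (K - 0) * (20 + 1 + bcost ?g))" if "?I 0 s'" for s' t
  proof (rule wp_While[where I = ?I])
    show "?I 0 s'" by (rule that)
    fix i s' t assume I: "?I i s'" and "bval ?g s'"
    then have i: "i < K" "s' y i = c" by auto
    have "val ?b K ((s' y)(i := 0)) + c * ?b ^ i = val ?b K (s' y)"
      using val_upd[OF i(1), of ?b "s' y" 0] i(2) by simp
    then show "i < K \<and> wp ?p s' t (\<lambda>s' t'. ?I (Suc i) s' \<and> t' \<le> t + 20)"
      using I i y l by auto
  qed simp
  show ?thesis
    unfolding inc_def wp_Seq wp_Wr
  proof (rule wp_conseq[OF loop])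
    show "?I 0 (s(''i'' := (s ''i'')(aval (N 0) s := aval (N 0) s)))"
      using s y l by auto
  next
    fix s' t'
    assume "(\<exists>i\<le>K. ?I i s') \<and> \<not> bval ?g s' \<and> t' \<le> t + (1 + acost (N 0) + acost (N 0)) +
       Suc (K - 0) * (20 + 1 + bcost ?g)"
    then obtain i where I: "?I i s'" and i: "i < K \<Longrightarrow> s' y i \<noteq> c"
      and t': "t' \<le> t + 3 + Suc K * 36" by (auto simp: eval_nat_numeral)
    show "wp (If (Less (Var ''i'') (Var l))
       (Wr y (Var ''i'') (Plus (Rd y (Var ''i'')) (N 1));; ''ov'' ::= N 0)
       (''ov'' ::= N 1)) s' t' (\<lambda>s' t'. (\<forall>j<K. s' y j \<le> c) \<and> (\<forall>j\<ge>K. s' y j = s y j) \<and>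
     (if Suc (val (Suc c) K (s y)) < Suc c ^ K
      then s' ''ov'' 0 = 0 \<and> val (Suc c) K (s' y) = Suc (val (Suc c) K (s y))
      else s' ''ov'' 0 = 1 \<and> Suc (val (Suc c) K (s y)) = Suc c ^ K \<and> (\<forall>j<K. s' y j = 0)) \<and>
     t' \<le> t + 60 * Suc K)"
    proof (cases "i < K")
      case True
      let ?y = "(s' y)(i := Suc (s' y i))"
      have "val ?b K ?y = Suc ?v"
        using val_upd[OF True, of ?b "s' y" "Suc (s' y i)"] I by simp
      moreover have "val ?b K ?y < ?b ^ K"
        using I i[OF True] True by (intro val_less) (auto simp: less_Suc_eq_le le_less)
      ultimately show ?thesis using I True y l t' i by (auto simp: Suc_le_eq le_less)
    next
      case False
      \<comment> \<open>Now the invariant reads \<open>val ?b K (s' y) + ?b ^ K = Suc ?v\<close>,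
        and the right-hand side is at most \<open>?b ^ K\<close>; hence the digits are all
        0.\<close>
      with I have "i = K" by simp
      with I v have *: "val ?b K (s' y) = 0" "Suc ?v = ?b ^ K" by auto
      from val_eq_0[OF this(1)] have "\<forall>j<K. s' y j = 0" by simp
      with * I \<open>i = K\<close> y l t' show ?thesis by auto
    qed
  qed
qed

section \<open>Memory representation and analysis of the search\<close>

context multi_stc
begin

text \<open>Beyond the input, this fixes the tables built by preprocessing. No later phase writes to
  \<open>env_vars\<close>, so \<open>env\<close> survives by framing. \<open>off\<close> and
  \<open>row\<close> hold the multiples of \<open>n\<close> and \<open>c\<close> that serve as row
  addresses.\<close>

definition env :: "state \<Rightarrow> bool" where
  "env s \<longleftrightarrow> s ''n'' 0 = n \<and> s ''m'' 0 = m \<and> s ''c'' 0 = c \<and> s ''k'' 0 = k \<and>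
     (\<forall>i<m. s ''u'' i = fst (es ! i) \<and> s ''v'' i = snd (es ! i)) \<and>
     (\<forall>i<m. \<forall>a<c. s ''psi'' (i * c + a) = (if Suc a \<in> \<Psi> (ed i) then 1 else 0)) \<and>
     (\<forall>i<n. s ''off'' i = i * n) \<and> (\<forall>i<m. s ''row'' i = i * c) \<and>
     (\<forall>a<n. \<forall>b<n. s ''adj'' (a * n + b) = adjn a b)"

abbreviation env_vars :: "string set" where
  "env_vars \<equiv> {''n'', ''m'', ''c'', ''k'', ''u'', ''v'', ''psi'', ''off'', ''row'', ''adj''}"

lemma env_cong: "\<forall>x\<in>env_vars. s' x = s x \<Longrightarrow> env s' = env s"
  by (simp add: env_def)

lemma env_upd [simp]: "x \<notin> env_vars \<Longrightarrow> env (s(x := f)) = env s"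
  by (rule env_cong) auto

lemma ends_less: "i < m \<Longrightarrow> fst (es ! i) < n \<and> snd (es ! i) < n"
  using ed_in[of i] edge_lt unfolding ed_def by auto

lemma wp_conf:
  assumes "env s" "s ''e'' 0 = e" "e < m" "s ''w'' 0 = w" "w < n"
  shows "wp conf_com s t (\<lambda>s' t'. s' ''f'' 0 = cfl e w \<and> t' \<le> t + 80)"
  using assms ends_less[of e]
  by (auto simp: conf_com_def env_def cfl_def Let_def)

text \<open>The last conjunct makes the successor of \<open>it\<close> a fresh stamp, so raising
  \<open>it\<close> empties the represented set in constant time.\<close>

definition cov_rep :: "nat list \<Rightarrow> state \<Rightarrow> bool" where
  "cov_rep L s \<longleftrightarrow> s ''J'' 0 = length L \<and> (\<forall>i<length L. s ''cov'' i = L ! i) \<and>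
     (\<forall>z. s ''in'' z = s ''it'' 0 \<longleftrightarrow> z \<in> set L) \<and> (\<forall>z. s ''in'' z \<le> s ''it'' 0)"

lemma cov_rep_cong:
  "\<forall>x\<in>{''J'', ''cov'', ''in'', ''it''}. s' x = s x \<Longrightarrow> cov_rep L s' = cov_rep L s"
  by (simp add: cov_rep_def)

lemma cov_rep_upd [simp]:
  "x \<notin> {''J'', ''cov'', ''in'', ''it''} \<Longrightarrow> cov_rep L (s(x := f)) = cov_rep L s"
  by (rule cov_rep_cong) auto

lemma wp_scan_step:
  assumes s: "env s" "s ''e'' 0 = e" "e < m" "s ''w'' 0 = w" "w < n"
    and L: "cov_rep L s"
  shows "wp scan_step s t (\<lambda>s' t'.
     cov_rep (if cfl e w = 0 then L else pick (s ''x'') (e, cfl e w - 1) L) s' \<and> t' \<le> t + 180)"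
  unfolding scan_step_def wp_Seq
proof (rule wp_conseq[OF wp_conf[OF s]])
  fix s' t' assume 1: "s' ''f'' 0 = cfl e w \<and> t' \<le> t + 80"
    and fr: "\<And>x. x \<notin> writes conf_com \<Longrightarrow> s' x = s x"
  have eq: "s' ''e'' = s ''e''" "s' ''in'' = s ''in''" "s' ''it'' = s ''it''" "s' ''x'' = s ''x''"
    "s' ''J'' = s ''J''" "s' ''cov'' = s ''cov''"
    by (rule fr; simp add: conf_com_def)+
  show "wp (If (And (Less (N 0) (Var ''f''))
         (And (Not (Eq (Rd ''in'' (Var ''e'')) (Var ''it'')))
              (Not (Eq (Rd ''in'' (Minus (Var ''f'') (N 1))) (Var ''it'')))))
       (If (Eq (Rd ''x'' (Var ''J'')) (N 0))
          (''g'' ::= Var ''e'') (''g'' ::= Minus (Var ''f'') (N 1));;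
        Wr ''in'' (Var ''g'') (Var ''it'');;
        Wr ''cov'' (Var ''J'') (Var ''g'');;
        ''J'' ::= Plus (Var ''J'') (N 1))
       Skip) s' t' (\<lambda>s' t'.
     cov_rep (if cfl e w = 0 then L else pick (s ''x'') (e, cfl e w - 1) L) s' \<and> t' \<le> t + 180)"
    using 1 L s(2) by (auto simp: eq cov_rep_def pick_def nth_append less_Suc_eq)
qed

lemma wp_scan:
  assumes "env s" "\<And>z. s ''in'' z \<le> s ''it'' 0" "0 < m" "0 < n"
  shows "wp scan s t (\<lambda>s' t'. cov_rep (covl (s ''x'')) s' \<and> t' \<le> t + 900 * (m * n))"
proof -
  let ?x = "s ''x''"
  let ?I = "\<lambda>e w s'. env s' \<and> s' ''x'' = ?x \<and> cov_rep (cov_upto ?x e w) s'"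
  have row: "wp (For ''w'' ''n'' scan_step) s' t (\<lambda>s' t'. ?I (Suc e) 0 s' \<and> t' \<le> t + Suc n * 196)"
    if "?I e 0 s'" "s' ''e'' 0 = e" "e < m" for s' t e
  proof -
    have "wp (For ''w'' ''n'' scan_step) s' t (\<lambda>s' t'. (?I e n s' \<and> s' ''e'' 0 = e) \<and> t' \<le> t + Suc n * (180 + 16))"
    proof (rule wp_For[where I = "\<lambda>w s'. ?I e w s' \<and> s' ''e'' 0 = e"])
      show "s' ''n'' 0 = n" using that by (simp add: env_def)
      fix w s t assume *: "w < n" "?I e w s \<and> s ''e'' 0 = e" "s ''w'' 0 = w" 
      show "wp scan_step s t (\<lambda>s' t'.
         (?I e (Suc w) (s'(''w'' := (s' ''w'')(0 := Suc w))) \<and> (s'(''w'' := (s' ''w'')(0 := Suc w))) ''e'' 0 = e) \<and> t' \<le> t + 180)"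
      proof (rule wp_conseq[OF wp_scan_step])
        show "env s" "cov_rep (cov_upto ?x e w) s" "s ''e'' 0 = e" "e < m" "s ''w'' 0 = w" "w < n"
          using * that by auto
        fix s' t' assume 1: "cov_rep (if cfl e w = 0 then cov_upto ?x e w else pick (s ''x'') (e, cfl e w - 1) (cov_upto ?x e w)) s' \<and> t' \<le> t + 180"
         and fr: "\<And>x. x \<notin> writes scan_step \<Longrightarrow> s' x = s x"
        have "env s' = env s" by (rule env_cong) (simp add: fr scan_step_def conf_com_def)
        moreover have "s' ''x'' = s ''x''" "s' ''e'' = s ''e''" by (rule fr; simp add: scan_step_def conf_com_def)+
        ultimately show "(?I e (Suc w) (s'(''w'' := (s' ''w'')(0 := Suc w))) \<and> (s'(''w'' := (s' ''w'')(0 := Suc w))) ''e'' 0 = e) \<and> t' \<le> t + 180"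
          using 1 * by (auto simp: cov_upto_simps(2))
      qed
    qed (use that in \<open>auto simp: scan_step_def conf_com_def\<close>)
    then show ?thesis by (rule wp_conseq) (auto simp: cov_upto_simps(3))
  qed
  have loop: "wp (For ''e'' ''m'' (For ''w'' ''n'' scan_step)) s' t
    (\<lambda>s' t'. ?I m 0 s' \<and> t' \<le> t + Suc m * (Suc n * 196 + 16))"
    if "?I 0 0 s'" for s' t
  proof (rule wp_For[where I = "\<lambda>e. ?I e 0"])
    show "s' ''m'' 0 = m" using that by (simp add: env_def)
    fix e s t assume *: "e < m" "?I e 0 s" "s ''e'' 0 = e"
    show "wp (For ''w'' ''n'' scan_step) s t
      (\<lambda>s' t'. ?I (Suc e) 0 (s'(''e'' := (s' ''e'')(0 := Suc e))) \<and> t' \<le> t + Suc n * 196)"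
      by (rule wp_conseq[OF row]) (use * in auto)
  qed (use that in \<open>auto simp: scan_step_def conf_com_def\<close>)
  \<comment> \<open>For positive \<open>m\<close> and \<open>n\<close> a successor is at most the
    double, so lower-order terms vanish into the constant 2 * (2 * 196 + 16) = 816.\<close>
  have "Suc m * (Suc n * 196 + 16) \<le> (2 * m) * (2 * n * 196 + 16 * n)"
    using assms(3,4) by (intro mult_mono) (auto simp: Suc_le_eq)
  then have T: "Suc m * (Suc n * 196 + 16) \<le> 816 * (m * n)" by simp
  have mn: "m * n \<ge> 1" using assms(3,4) nat_0_less_mult_iff[of m n] by linarith
  let ?s = "s(''it'' := (s ''it'')(0 := Suc (s ''it'' 0)), ''J'' := (s ''J'')(0 := 0))"
  have in_it: "s ''in'' z \<noteq> Suc (s ''it'' 0)" "s ''in'' z \<le> Suc (s ''it'' 0)" for z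
    using assms(2)[of z] by auto
  have "wp (For ''e'' ''m'' (For ''w'' ''n'' scan_step)) ?s t2
     (\<lambda>s' t'. cov_rep (covl (s ''x'')) s' \<and> t' \<le> t + 900 * (m * n))" if "t2 \<le> t + 20" for t2
    by (rule wp_conseq[OF loop]) (use assms(1) in_it T mn that in \<open>auto simp: cov_upto_simps(1) cov_rep_def\<close>)
  then show ?thesis by (simp add: scan_def)
qed


text \<open>The loop index is the position of the current vector, and \<open>M\<close> is the
  position of a vector known to succeed. The search may stop earlier but cannot pass
  \<open>M\<close>; this bounds the number of rounds and, through \<open>K\<close>, the length of
  the cover found.\<close>

lemma wp_search:
  assumes s: "env s" "\<And>z. s ''in'' z \<le> s ''it'' 0" "s ''K'' 0 = 0" "s ''x'' = (\<lambda>_. 0)"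
    and mn: "0 < m" "0 < n" and c: "0 < c"
  shows "wp search s t (\<lambda>s' t'. (\<exists>L. cov_rep L s' \<and> cover (set L) \<and> distinct L \<and> length L \<le> k1 E) \<and>
     t' \<le> t + 3300 * (Suc c ^ k1 E * (m * n)))"
proof -
  let ?b = "Suc c"
  obtain x where x: "\<forall>i. x i \<le> 1" "\<forall>i\<ge>k1 E. x i = (0::nat)" "length (covl x) \<le> k1 E"
    using ex_covl_short by blast
  \<comment> \<open>With at least one color, the digits 0 and 1 both lie below the base.\<close>
  have xb: "x i < ?b" for i using x(1) c by (metis One_nat_def Suc_leI le_less_trans less_Suc_eq_le)
  define M where "M = pos ?b (k1 E) x"
  define T where "T = 60 * Suc m + 12 + 900 * (m * n)"
  let ?I = "\<lambda>i s. env s \<and> cov_rep (covl (s ''x'')) s \<and> (\<forall>j. s ''x'' j < ?b) \<and>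
    (\<forall>j\<ge>s ''K'' 0. s ''x'' j = 0) \<and> s ''K'' 0 \<le> k1 E \<and> i = pos ?b (s ''K'' 0) (s ''x'') \<and> i \<le> M"
  let ?g = "Less (Var ''K'') (Var ''J'')"
  let ?inc = "If (Eq (Var ''ov'') (N 1)) (''K'' ::= Plus (Var ''K'') (N 1)) Skip"
  have pos0: "pos ?b 0 (\<lambda>_. 0) = 0" by (simp add: pos_def)
  have step: "i < M \<and> wp (inc ''x'' ''K'';; ?inc;; scan) s t (\<lambda>s' t'. ?I (Suc i) s' \<and> t' \<le> t + T)"
    if I: "?I i s" and g: "bval ?g s" for i s t
  proof -
    let ?K = "s ''K'' 0" and ?x = "s ''x''"
    have xs: "\<And>j. ?x j < ?b" "\<And>j. j \<ge> ?K \<Longrightarrow> ?x j = 0" and K: "?K \<le> k1 E" using I by auto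
    have long: "?K < length (covl ?x)" using I g by (simp add: cov_rep_def)
    \<comment> \<open>At position \<open>M\<close> the current vector is \<open>x\<close> itself,
      whose cover is short; the guard says the opposite.\<close>
    have "i \<noteq> M"
    proof
      assume "i = M"
      with I have eq: "pos ?b ?K ?x = pos ?b (k1 E) x" by (simp add: M_def)
      then have "?K = k1 E" using pos_inj[of ?K ?x ?b "k1 E" x] xs(1) xb by blast
      with eq have "val ?b (k1 E) ?x = val ?b (k1 E) x" by (simp add: pos_def)
      then have "?x j = x j" if "j < k1 E" for j using val_inj[of "k1 E" ?x ?b x j] that xs(1) xb by blast
      then have "?x = x" using xs(2) x(2) \<open>?K = k1 E\<close> by (metis ext not_le)
      with long x(3) \<open>?K = k1 E\<close> show False by simp
    qed
    with I have iM: "i < M" by simp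
    have "wp (inc ''x'' ''K'';; ?inc;; scan) s t (\<lambda>s' t'. ?I (Suc i) s' \<and> t' \<le> t + T)"
      unfolding wp_Seq
    proof (rule wp_conseq[OF wp_inc])
      show "s ''c'' 0 = c" using I by (simp add: env_def)
      show "?x j \<le> c" for j using xs(1)[of j] by simp
    next
      fix s' t'
      assume inc: "(\<forall>j<?K. s' ''x'' j \<le> c) \<and> (\<forall>j\<ge>?K. s' ''x'' j = s ''x'' j) \<and>
       (if Suc (val ?b ?K ?x) < ?b ^ ?K
        then s' ''ov'' 0 = 0 \<and> val ?b ?K (s' ''x'') = Suc (val ?b ?K ?x)
        else s' ''ov'' 0 = 1 \<and> Suc (val ?b ?K ?x) = ?b ^ ?K \<and> (\<forall>j<?K. s' ''x'' j = 0)) \<and>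
       t' \<le> t + 60 * Suc ?K"
       and fr: "\<And>y. y \<notin> writes (inc ''x'' ''K'') \<Longrightarrow> s' y = s y"
      have eq: "s' ''K'' = s ''K''" "s' ''J'' = s ''J''" "s' ''in'' = s ''in''" "s' ''it'' = s ''it''"
        by (simp_all add: fr)
      have env: "env s'" using I env_cong[of s' s] by (simp add: fr)
      have xs': "s' ''x'' j < ?b" "j \<ge> ?K \<Longrightarrow> s' ''x'' j = 0" for j
        using inc xs by (cases "j < ?K"; auto simp: less_Suc_eq_le)+
      have in_it: "s' ''in'' z \<le> s' ''it'' 0" for z using I by (simp add: eq cov_rep_def)
      define s2 where "s2 = (if s' ''ov'' 0 = 1 then s'(''K'' := (s' ''K'')(0 := Suc ?K)) else s')"
      have s2: "env s2" "s2 ''x'' = s' ''x''" "s2 ''in'' = s' ''in''" "s2 ''it'' = s' ''it''"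
        using env by (auto simp: s2_def)
      have K2: "s2 ''K'' 0 \<le> k1 E \<and> (\<forall>j\<ge>s2 ''K'' 0. s' ''x'' j = 0) \<and>
        pos ?b (s2 ''K'' 0) (s' ''x'') = Suc i"
      proof (cases "Suc (val ?b ?K ?x) < ?b ^ ?K")
        case True
        then have "s2 ''K'' 0 = ?K" using inc by (simp add: s2_def eq)
        with True inc I K xs' show ?thesis by (simp add: pos_def)
      next
        case False
        with inc have "s2 ''K'' 0 = Suc ?K" by (simp add: s2_def)
        moreover have x0: "s' ''x'' j = 0" for j using False inc xs' by (cases "j < ?K") auto
        \<comment> \<open>The value drops to 0, but the prefix sum grows by \<open>?b ^ ?K\<close>,
          which is exactly the old value plus one.\<close>
        moreover have pos: "pos ?b (Suc ?K) (s' ''x'') = Suc i"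
          using False inc I x0 by (simp add: pos_def val_def)
        moreover have "Suc ?K \<le> k1 E"
        proof (rule ccontr)
          assume "\<not> Suc ?K \<le> k1 E"
          with K have K: "?K = k1 E" by simp
          \<comment> \<open>Vectors of length \<open>k1 E\<close> precede all longer ones, so
            growing beyond that length would mean that \<open>M\<close> has been skipped.\<close>
          have "M < (\<Sum>j<Suc ?K. ?b ^ j)" unfolding M_def K by (rule pos_less_Suc) (rule xb)
          also have "\<dots> \<le> pos ?b (Suc ?K) (s' ''x'')" by (simp add: pos_def)
          finally show False using pos iM by simp
        qed
        ultimately show ?thesis by simp
      qed
      have T: "60 * Suc ?K \<le> 60 * Suc m" using K k1_le by simp
      have "wp scan s2 t2 (\<lambda>s' t'. ?I (Suc i) s' \<and> t' \<le> t + T)" if "t2 \<le> t' + 12" for t2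
      proof (rule wp_conseq[OF wp_scan])
        show "env s2" "\<And>z. s2 ''in'' z \<le> s2 ''it'' 0" "0 < m" "0 < n" using s2 in_it mn by auto
        fix s3 t3 assume 3: "cov_rep (covl (s2 ''x'')) s3 \<and> t3 \<le> t2 + 900 * (m * n)"
          and fr: "\<And>y. y \<notin> writes scan \<Longrightarrow> s3 y = s2 y"
        have eq3: "s3 ''x'' = s' ''x''" "s3 ''K'' = s2 ''K''" by (simp_all add: fr s2)
        have "env s3" using s2(1) env_cong[of s3 s2] by (simp add: fr)
        moreover have "cov_rep (covl (s3 ''x'')) s3" using 3 s2(2) eq3 by simp
        moreover have "t3 \<le> t + T" using 3 inc that T unfolding T_def by linarith
        ultimately show "?I (Suc i) s3 \<and> t3 \<le> t + T" using K2 xs'(1) iM by (simp add: eq3)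
      qed
      then show "wp ?inc s' t' (\<lambda>s' t'. wp scan s' t' (\<lambda>s' t'. ?I (Suc i) s' \<and> t' \<le> t + T))"
        by (auto simp: s2_def eq)
    qed simp_all
    with iM show ?thesis by simp
  qed
  have bk: "1 \<le> Suc c ^ k1 E" by simp
  have mn1: "1 \<le> m * n" using mn nat_0_less_mult_iff[of m n] by linarith
  have mmn: "Suc m \<le> 2 * (m * n)" 
  proof -
    have "m \<le> m * n" using mn by simp
    with mn1 show ?thesis by linarith
  qed
  have M: "Suc M \<le> 2 * Suc c ^ k1 E"
    unfolding M_def using pos_less[of "k1 E" x ?b] xb c by (simp add: Suc_le_eq)
  have "a + 12 + 900 * p + 7 \<le> 1150 * p" if "a \<le> 120 * p" "1 \<le> p" for a p :: nat
    using that by linarith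
  from this[of "60 * Suc m", OF _ mn1] have "T + 7 \<le> 1150 * (m * n)"
    using mult_le_mono2[OF mmn, of 60] by (simp add: T_def)
  then have "Suc (M - 0) * (T + 1 + bcost ?g) \<le> (2 * Suc c ^ k1 E) * (1150 * (m * n))"
    using M by (intro mult_mono) auto
  moreover have "m * n \<le> Suc c ^ k1 E * (m * n)" using bk by simp
  ultimately have T: "900 * (m * n) + Suc (M - 0) * (T + 1 + bcost ?g) \<le> 3300 * (Suc c ^ k1 E * (m * n))"
    by (simp only: mult_ac)
  show ?thesis
    unfolding search_def wp_Seq[of scan]
  proof (rule wp_conseq[OF wp_scan[OF s(1,2) mn]])
    fix s1 t1 assume 1: "cov_rep (covl (s ''x'')) s1 \<and> t1 \<le> t + 900 * (m * n)"
      and fr: "\<And>y. y \<notin> writes scan \<Longrightarrow> s1 y = s y"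
    have eq: "s1 ''x'' = (\<lambda>_. 0)" "s1 ''K'' 0 = 0" by (simp_all add: fr s)
    have env: "env s1" using s(1) env_cong[of s1 s] by (simp add: fr)
    show "wp (While ?g (inc ''x'' ''K'';; ?inc;; scan)) s1 t1
      (\<lambda>s' t'. (\<exists>L. cov_rep L s' \<and> cover (set L) \<and> distinct L \<and> length L \<le> k1 E) \<and>
        t' \<le> t + 3300 * (Suc c ^ k1 E * (m * n)))"
    proof (rule wp_conseq[OF wp_While[where I = ?I and i = 0 and B = M and T = T]])
      show "?I 0 s1" using 1 s eq env pos0 by simp
      fix s' t' assume fin: "(\<exists>j\<le>M. ?I j s') \<and> \<not> bval ?g s' \<and>
        t' \<le> t1 + Suc (M - 0) * (T + 1 + bcost ?g)"
      then have "cov_rep (covl (s' ''x'')) s'" "length (covl (s' ''x'')) \<le> k1 E"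
        by (auto simp: cov_rep_def)
      moreover have "t' \<le> t + 3300 * (Suc c ^ k1 E * (m * n))" using fin 1 T by linarith
      ultimately show "(\<exists>L. cov_rep L s' \<and> cover (set L) \<and> distinct L \<and> length L \<le> k1 E) \<and>
        t' \<le> t + 3300 * (Suc c ^ k1 E * (m * n))"
        using cover_covl distinct_cov_upto by blast
    qed (use step in auto)
  qed
qed

end

section \<open>Trying all colorings of the cover\<close>

text \<open>A cover edge with digit 0 marks cell 0, which belongs to no color: being weak, it blocks
  nothing.\<close>

definition mark_step :: com where
  "mark_step =
     conf_com;;
     If (And (Less (N 0) (Var ''f'')) (Eq (Rd ''in'' (Minus (Var ''f'') (N 1))) (Var ''it'')))
       (Wr ''mark'' (Rd ''col'' (Minus (Var ''f'') (N 1))) (Var ''st'')) Skip"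

text \<open>Table columns count from 0 and colors from 1; hence \<open>a\<close> for
  \<open>psi\<close>, but \<open>a + 1\<close> for \<open>mark\<close> and
  \<open>col\<close>.\<close>

definition color_step :: com where
  "color_step =
     If (And (Eq (Rd ''psi'' (Plus (Rd ''row'' (Var ''e'')) (Var ''a''))) (N 1))
         (And (Not (Eq (Rd ''mark'' (Plus (Var ''a'') (N 1))) (Var ''st'')))
              (Not (And (Eq (Rd ''in'' (Var ''e'')) (Var ''it''))
                        (Not (Eq (Rd ''col'' (Var ''e'')) (Plus (Var ''a'') (N 1))))))))
       (''ok'' ::= N 1) Skip"

definition edge_step :: com where
  "edge_step =
     ''st'' ::= Plus (Var ''st'') (N 1);;
     For ''w'' ''n'' mark_step;;
     ''ok'' ::= N 0;;
     For ''a'' ''c'' color_step;;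
     If (Eq (Var ''ok'') (N 0)) (''W'' ::= Plus (Var ''W'') (N 1)) Skip"

text \<open>\<open>answer\<close> is only ever raised to 1, so over all rounds it becomes the
  disjunction of the single verdicts.\<close>

definition evaluate :: com where
  "evaluate =
     For ''i'' ''J'' (Wr ''col'' (Rd ''cov'' (Var ''i'')) (Rd ''y'' (Var ''i'')));;
     ''W'' ::= N 0;;
     For ''e'' ''m'' edge_step;;
     If (Less (Var ''k'') (Var ''W'')) Skip (''answer'' ::= N 1)"

text \<open>Evaluation precedes each increment, so the zero vector is tried too, and an empty cover
  gets exactly one round.\<close>

definition color_all :: com where
  "color_all = While (Eq (Var ''ov'') (N 0)) (evaluate;; inc ''y'' ''J'')"

lemma writes_mark [simp]: "writes mark_step = {''f'', ''g'', ''mark''}"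
  by (auto simp: mark_step_def conf_com_def)

lemma writes_color [simp]: "writes color_step = {''ok''}"
  by (auto simp: color_step_def)

lemma writes_edge [simp]:
  "writes edge_step = {''st'', ''w'', ''f'', ''g'', ''mark'', ''ok'', ''a'', ''W''}"
  by (auto simp: edge_step_def)

lemma writes_evaluate [simp]:
  "writes evaluate = {''i'', ''col'', ''W'', ''e'', ''st'', ''w'', ''f'', ''g'', ''mark'', ''ok'', ''a'', ''answer''}"
  by (auto simp: evaluate_def)

section \<open>Correctness and cost of the coloring phase\<close>

context multi_stc
begin

definition marked :: "nat list \<Rightarrow> (nat \<Rightarrow> nat) \<Rightarrow> nat \<Rightarrow> nat \<Rightarrow> nat \<Rightarrow> bool" where
  "marked L \<phi> e w \<alpha> \<longleftrightarrow> (\<exists>i<w. \<exists>f\<in>set L. cfl e i = Suc f \<and> \<phi> f = \<alpha>)"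

lemma marked_0 [simp]: "\<not> marked L \<phi> e 0 \<alpha>"
  by (simp add: marked_def)

lemma marked_Suc: "marked L \<phi> e (Suc w) \<alpha> \<longleftrightarrow>
    marked L \<phi> e w \<alpha> \<or> (\<exists>f\<in>set L. cfl e w = Suc f \<and> \<phi> f = \<alpha>)"
  by (auto simp: marked_def less_Suc_eq)

lemma marked_n: "e < m \<Longrightarrow> marked L \<phi> e n \<alpha> \<longleftrightarrow> (\<exists>f\<in>set L. conf e f \<and> \<phi> f = \<alpha>)"
  using cfl_iff[of e] unfolding marked_def by blast

lemma wp_mark_step:
  assumes s: "env s" "s ''e'' 0 = e" "e < m" "s ''w'' 0 = w" "w < n"
    and L: "cov_rep L s" and mark: "\<And>\<alpha>. s ''mark'' \<alpha> = s ''st'' 0 \<longleftrightarrow> marked L (s ''col'') e w \<alpha>"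
      "\<And>\<alpha>. s ''mark'' \<alpha> \<le> s ''st'' 0"
  shows "wp mark_step s t (\<lambda>s' t'.
     (\<forall>\<alpha>. s' ''mark'' \<alpha> = s ''st'' 0 \<longleftrightarrow> marked L (s ''col'') e (Suc w) \<alpha>) \<and>
     (\<forall>\<alpha>. s' ''mark'' \<alpha> \<le> s ''st'' 0) \<and> t' \<le> t + 120)"
  unfolding mark_step_def wp_Seq
proof (rule wp_conseq[OF wp_conf[OF s]])
  fix s' t' assume 1: "s' ''f'' 0 = cfl e w \<and> t' \<le> t + 80"
    and fr: "\<And>x. x \<notin> writes conf_com \<Longrightarrow> s' x = s x"
  have eq: "s' ''e'' = s ''e''" "s' ''in'' = s ''in''" "s' ''it'' = s ''it''" "s' ''col'' = s ''col''"
    "s' ''mark'' = s ''mark''" "s' ''st'' = s ''st''"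
    by (rule fr; simp add: conf_com_def)+
  have "s ''in'' z = s ''it'' 0 \<longleftrightarrow> z \<in> set L" for z using L by (simp add: cov_rep_def)
  then show "wp (If (And (Less (N 0) (Var ''f''))
           (Eq (Rd ''in'' (Minus (Var ''f'') (N 1))) (Var ''it'')))
       (Wr ''mark'' (Rd ''col'' (Minus (Var ''f'') (N 1))) (Var ''st'')) Skip) s' t' (\<lambda>s' t'.
     (\<forall>\<alpha>. s' ''mark'' \<alpha> = s ''st'' 0 \<longleftrightarrow> marked L (s ''col'') e (Suc w) \<alpha>) \<and>
     (\<forall>\<alpha>. s' ''mark'' \<alpha> \<le> s ''st'' 0) \<and> t' \<le> t + 120)"
    using 1 mark by (cases "cfl e w") (auto simp: eq marked_Suc)
qed

lemma weak_edges_cong: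
  "(\<And>f. f \<in> C \<Longrightarrow> \<phi> f = \<psi> f) \<Longrightarrow> weak_edges C \<phi> = weak_edges C \<psi>"
  unfolding weak_edges_def by (intro Collect_cong) (metis (mono_tags))

definition colorable :: "nat set \<Rightarrow> (nat \<Rightarrow> nat) \<Rightarrow> nat \<Rightarrow> nat \<Rightarrow> bool" where
  "colorable C \<phi> e \<alpha> \<longleftrightarrow> \<alpha> \<in> \<Psi> (ed e) \<and> (\<forall>f\<in>C. conf e f \<longrightarrow> \<phi> f \<noteq> \<alpha>) \<and> (e \<in> C \<longrightarrow> \<phi> e = \<alpha>)"

text \<open>Since the lists contain only colors in \<open>{1..c}\<close>, running through the
  \<open>c\<close> table columns misses no admissible color.\<close>

lemma weak_edges_colorable:
  "e \<in> weak_edges C \<phi> \<longleftrightarrow> e < m \<and> \<not> (\<exists>a<c. colorable C \<phi> e (Suc a))"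
proof -
  have "(\<exists>\<alpha>\<in>\<Psi> (ed e). P \<alpha>) \<longleftrightarrow> (\<exists>a<c. Suc a \<in> \<Psi> (ed e) \<and> P (Suc a))" if "e < m" for P
  proof
    assume "\<exists>\<alpha>\<in>\<Psi> (ed e). P \<alpha>"
    then obtain \<alpha> where "\<alpha> \<in> \<Psi> (ed e)" "P \<alpha>" by blast
    moreover from this lists ed_in[OF that] have "\<alpha> \<in> {1..c}" by blast
    ultimately show "\<exists>a<c. Suc a \<in> \<Psi> (ed e) \<and> P (Suc a)" by (intro exI[of _ "\<alpha> - 1"]) auto
  qed blast
  then show ?thesis
    by (cases "e < m")
       (simp_all only: weak_edges_def colorable_def mem_Collect_eq simp_thms)
qed

lemma wp_edge_step:
  assumes s: "env s" "s ''e'' 0 = e" "e < m" and L: "cov_rep L s"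
    and mark: "\<And>\<alpha>. s ''mark'' \<alpha> \<le> s ''st'' 0"
  shows "wp edge_step s t (\<lambda>s' t'.
     s' ''W'' 0 = (if e \<in> weak_edges (set L) (s ''col'') then Suc (s ''W'' 0) else s ''W'' 0) \<and>
     (\<forall>\<alpha>. s' ''mark'' \<alpha> \<le> s' ''st'' 0) \<and> t' \<le> t + (300 + 140 * n + 80 * c))"
proof -
  let ?s = "s(''st'' := (s ''st'')(0 := Suc (s ''st'' 0)))"
  let ?I = "\<lambda>w s'. env s' \<and> cov_rep L s' \<and> s' ''e'' 0 = e \<and> s' ''col'' = s ''col'' \<and>
    s' ''st'' 0 = Suc (s ''st'' 0) \<and> s' ''W'' = s ''W'' \<and>
    (\<forall>\<alpha>. s' ''mark'' \<alpha> = Suc (s ''st'' 0) \<longleftrightarrow> marked L (s ''col'') e w \<alpha>) \<and>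
    (\<forall>\<alpha>. s' ''mark'' \<alpha> \<le> Suc (s ''st'' 0))"
  let ?Q = "\<lambda>s' t'.
     s' ''W'' 0 = (if e \<in> weak_edges (set L) (s ''col'') then Suc (s ''W'' 0) else s ''W'' 0) \<and>
     (\<forall>\<alpha>. s' ''mark'' \<alpha> \<le> s' ''st'' 0) \<and> t' \<le> t + (300 + 140 * n + 80 * c)"
  \<comment> \<open>The new stamp exceeds every old mark, so no color is marked at the
    start.\<close>
  have I0: "?I 0 ?s" using s L mark by (auto simp: less_Suc_eq_le le_imp_less_Suc[THEN less_imp_neq] le_SucI)
  have marks: "wp (For ''w'' ''n'' mark_step) ?s t1 (\<lambda>s' t'. ?I n s' \<and> t' \<le> t1 + Suc n * (120 + 16))" for t1
  proof (rule wp_For[where I = ?I])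
    show "?s ''n'' 0 = n" using s by (simp add: env_def)
    fix w s1 t1 assume w: "w < n" "?I w s1" "s1 ''w'' 0 = w"
    show "wp mark_step s1 t1 (\<lambda>s' t'. ?I (Suc w) (s'(''w'' := (s' ''w'')(0 := Suc w))) \<and> t' \<le> t1 + 120)"
    proof (rule wp_conseq[OF wp_mark_step[of s1 e w L]])
      fix s' t' assume 1: "(\<forall>\<alpha>. s' ''mark'' \<alpha> = s1 ''st'' 0 \<longleftrightarrow> marked L (s1 ''col'') e (Suc w) \<alpha>) \<and>
         (\<forall>\<alpha>. s' ''mark'' \<alpha> \<le> s1 ''st'' 0) \<and> t' \<le> t1 + 120"
        and fr: "\<And>x. x \<notin> writes mark_step \<Longrightarrow> s' x = s1 x"
      have "env s' = env s1" by (rule env_cong) (simp add: fr)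
      moreover have "cov_rep L s' = cov_rep L s1" by (rule cov_rep_cong) (simp add: fr)
      ultimately show "?I (Suc w) (s'(''w'' := (s' ''w'')(0 := Suc w))) \<and> t' \<le> t1 + 120"
        using 1 w by (simp add: fr)
    qed (use w s in auto)
  qed (use I0 in auto)
  let ?R = "\<lambda>i s'. ?I n s' \<and> s' ''ok'' 0 = (if \<exists>a<i. colorable (set L) (s ''col'') e (Suc a) then 1 else 0)"
  have colors: "wp (For ''a'' ''c'' color_step) s1 t1 (\<lambda>s' t'. ?R c s' \<and> t' \<le> t1 + Suc c * (60 + 16))"
    if "?R 0 s1" for s1 t1
  proof (rule wp_For[where I = ?R])
    show "s1 ''c'' 0 = c" using that by (simp add: env_def)
    fix i s1 t1 assume i: "i < c" "?R i s1" "s1 ''a'' 0 = i"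
    have "s1 ''psi'' (e * c + i) = (if Suc i \<in> \<Psi> (ed e) then 1 else 0)" "s1 ''row'' e = e * c"
      using i s by (auto simp: env_def)
    moreover have "s1 ''in'' e = s1 ''it'' 0 \<longleftrightarrow> e \<in> set L" using i by (simp add: cov_rep_def)
    moreover have "s1 ''mark'' (Suc i) = Suc (s ''st'' 0) \<longleftrightarrow> (\<exists>f\<in>set L. conf e f \<and> s ''col'' f = Suc i)"
      using i(2) unfolding marked_n[OF s(3)] by blast
    moreover have "s1 ''st'' 0 = Suc (s ''st'' 0)" "s1 ''e'' 0 = e" "s1 ''col'' = s ''col''" using i by auto
    ultimately have *: "bval (And (Eq (Rd ''psi'' (Plus (Rd ''row'' (Var ''e'')) (Var ''a''))) (N 1))
         (And (Not (Eq (Rd ''mark'' (Plus (Var ''a'') (N 1))) (Var ''st'')))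
              (Not (And (Eq (Rd ''in'' (Var ''e'')) (Var ''it''))
                        (Not (Eq (Rd ''col'' (Var ''e'')) (Plus (Var ''a'') (N 1)))))))) s1 \<longleftrightarrow>
       colorable (set L) (s ''col'') e (Suc i)"
      using i(3) by (auto simp: colorable_def)
    show "wp color_step s1 t1 (\<lambda>s' t'. ?R (Suc i) (s'(''a'' := (s' ''a'')(0 := Suc i))) \<and> t' \<le> t1 + 60)"
      unfolding color_step_def wp_If * using i by (auto simp: less_Suc_eq)
  qed (use that in auto)
  have "wp (For ''w'' ''n'' mark_step) ?s t1
     (\<lambda>s' t'. wp (''ok'' ::= N 0;; For ''a'' ''c'' color_step;;
       If (Eq (Var ''ok'') (N 0)) (''W'' ::= Plus (Var ''W'') (N 1)) Skip) s' t' ?Q)"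
    if t1: "t1 \<le> t + 20" for t1
  proof (rule wp_conseq[OF marks])
    fix s2 t2 assume 2: "?I n s2 \<and> t2 \<le> t1 + Suc n * (120 + 16)"
    let ?s2 = "s2(''ok'' := (s2 ''ok'')(0 := 0))"
    have "wp (For ''a'' ''c'' color_step) ?s2 t3
       (\<lambda>s' t'. wp (If (Eq (Var ''ok'') (N 0)) (''W'' ::= Plus (Var ''W'') (N 1)) Skip) s' t' ?Q)"
      if t3: "t3 \<le> t2 + 20" for t3
    proof (rule wp_conseq[OF colors])
      show "?R 0 ?s2" using 2 by simp
      fix s4 t4 assume 4: "?R c s4 \<and> t4 \<le> t3 + Suc c * (60 + 16)"
      then have ok: "s4 ''ok'' 0 = 0 \<longleftrightarrow> e \<in> weak_edges (set L) (s ''col'')"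
        using s(3) by (auto simp: weak_edges_colorable)
      show "wp (If (Eq (Var ''ok'') (N 0)) (''W'' ::= Plus (Var ''W'') (N 1)) Skip) s4 t4 ?Q"
        using 4 2 t1 t3 ok by auto
    qed
    then show "wp (''ok'' ::= N 0;; For ''a'' ''c'' color_step;;
       If (Eq (Var ''ok'') (N 0)) (''W'' ::= Plus (Var ''W'') (N 1)) Skip) s2 t2 ?Q"
      by (simp only: wp_Seq wp_Wr aval.simps acost.simps)
  qed
  then show ?thesis
    unfolding edge_step_def by (simp only: wp_Seq wp_Wr aval.simps acost.simps) simp
qed


text \<open>The witness for \<open>\<phi>\<close> is the content of \<open>col\<close>. Only its
  values on the cover are described; \<open>weak_edges\<close> reads it nowhere else.\<close>

lemma wp_evaluate:
  assumes s: "env s" and L: "cov_rep L s" "distinct L" "length L \<le> m"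
    and mark: "\<And>\<alpha>. s ''mark'' \<alpha> \<le> s ''st'' 0" and mn: "0 < m" "0 < n"
  shows "wp evaluate s t (\<lambda>s' t'.
     (\<exists>\<phi>. (\<forall>j<length L. \<phi> (L ! j) = s ''y'' j) \<and>
        s' ''answer'' 0 = (if card (weak_edges (set L) \<phi>) \<le> k then 1 else s ''answer'' 0)) \<and>
     (\<forall>\<alpha>. s' ''mark'' \<alpha> \<le> s' ''st'' 0) \<and> t' \<le> t + 1200 * (m * (n + c)))"
proof -
  let ?Q = "\<lambda>s' t'. (\<exists>\<phi>. (\<forall>j<length L. \<phi> (L ! j) = s ''y'' j) \<and>
        s' ''answer'' 0 = (if card (weak_edges (set L) \<phi>) \<le> k then 1 else s ''answer'' 0)) \<and>
     (\<forall>\<alpha>. s' ''mark'' \<alpha> \<le> s' ''st'' 0) \<and> t' \<le> t + 1200 * (m * (n + c))"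
  let ?T = "300 + 140 * n + 80 * c"
  have mn1: "1 \<le> m * (n + c)" using mn nat_0_less_mult_iff[of m "n + c"] by linarith
  have m_le: "m \<le> m * (n + c)" using mn by simp
  have "Suc (length L) \<le> 2 * (m * (n + c))" using L(3) m_le mn1 by linarith
  from mult_le_mono1[OF this, of 36]
  have T1: "Suc (length L) * (20 + 16) \<le> 72 * (m * (n + c))" by simp
  have "?T + 16 \<le> 456 * (n + c)" using mn by simp
  then have "Suc m * (?T + 16) \<le> (2 * m) * (456 * (n + c))" using mn by (intro mult_mono) (auto simp: Suc_le_eq)
  then have T2: "Suc m * (?T + 16) \<le> 912 * (m * (n + c))" by (simp only: mult_ac)
  let ?I = "\<lambda>i s'. env s' \<and> cov_rep L s' \<and> s' ''y'' = s ''y'' \<and> (\<forall>j<i. s' ''col'' (L ! j) = s ''y'' j)"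
  have cols: "wp (For ''i'' ''J'' (Wr ''col'' (Rd ''cov'' (Var ''i'')) (Rd ''y'' (Var ''i'')))) s t
    (\<lambda>s' t'. ?I (length L) s' \<and> t' \<le> t + Suc (length L) * (20 + 16))"
  proof (rule wp_For[where I = ?I])
    show "s ''J'' 0 = length L" using L by (simp add: cov_rep_def)
    fix i s1 t1 assume i: "i < length L" "?I i s1" "s1 ''i'' 0 = i"
    have "s1 ''cov'' i = L ! i" using i by (simp add: cov_rep_def)
    \<comment> \<open>Distinctness of \<open>L\<close> keeps a later write from overwriting the
      color of an earlier cover edge.\<close>
    moreover have "L ! j \<noteq> L ! i" if "j < i" for j
      using that i(1) L(2) by (simp add: nth_eq_iff_index_eq)
    ultimately show "wp (Wr ''col'' (Rd ''cov'' (Var ''i'')) (Rd ''y'' (Var ''i''))) s1 t1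
      (\<lambda>s' t'. ?I (Suc i) (s'(''i'' := (s' ''i'')(0 := Suc i))) \<and> t' \<le> t1 + 20)"
      using i by (auto simp: less_Suc_eq)
  qed (use s L in auto)
  show ?thesis
    unfolding evaluate_def wp_Seq
  proof (rule wp_conseq[OF cols])
    fix s1 t1 assume 1: "?I (length L) s1 \<and> t1 \<le> t + Suc (length L) * (20 + 16)"
      and fr: "\<And>x. x \<notin> writes (For ''i'' ''J'' (Wr ''col'' (Rd ''cov'' (Var ''i'')) (Rd ''y'' (Var ''i'')))) \<Longrightarrow> s1 x = s x"
    define \<phi> where "\<phi> = s1 ''col''"
    let ?W = "weak_edges (set L) \<phi>"
    let ?J = "\<lambda>e s'. env s' \<and> cov_rep L s' \<and> s' ''col'' = \<phi> \<and> s' ''answer'' 0 = s ''answer'' 0 \<and>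
      s' ''W'' 0 = card (?W \<inter> {..<e}) \<and> (\<forall>\<alpha>. s' ''mark'' \<alpha> \<le> s' ''st'' 0)"
    let ?s = "s1(''W'' := (s1 ''W'')(0 := 0))"
    have J0: "?J 0 ?s" using 1 mark by (simp add: \<phi>_def fr)
    have loop: "wp (For ''e'' ''m'' edge_step) ?s t2 (\<lambda>s' t'. ?J m s' \<and> t' \<le> t2 + Suc m * (?T + 16))" for t2
    proof (rule wp_For[where I = ?J])
      show "?s ''m'' 0 = m" using 1 by (simp add: env_def)
      fix e s2 t2 assume e: "e < m" "?J e s2" "s2 ''e'' 0 = e"
      show "wp edge_step s2 t2 (\<lambda>s' t'. ?J (Suc e) (s'(''e'' := (s' ''e'')(0 := Suc e))) \<and> t' \<le> t2 + ?T)"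
      proof (rule wp_conseq[OF wp_edge_step[of s2 e L]])
        fix s' t' assume 3: "s' ''W'' 0 = (if e \<in> weak_edges (set L) (s2 ''col'') then Suc (s2 ''W'' 0) else s2 ''W'' 0) \<and>
          (\<forall>\<alpha>. s' ''mark'' \<alpha> \<le> s' ''st'' 0) \<and> t' \<le> t2 + ?T"
          and fr: "\<And>x. x \<notin> writes edge_step \<Longrightarrow> s' x = s2 x"
        have "env s' = env s2" by (rule env_cong) (simp add: fr)
        moreover have "cov_rep L s' = cov_rep L s2" by (rule cov_rep_cong) (simp add: fr)
        moreover have "card (?W \<inter> {..<Suc e}) = (if e \<in> ?W then Suc (card (?W \<inter> {..<e})) else card (?W \<inter> {..<e}))"
          by (simp add: lessThan_Suc)
        ultimately show "?J (Suc e) (s'(''e'' := (s' ''e'')(0 := Suc e))) \<and> t' \<le> t2 + ?T"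
          using 3 e by (simp add: fr)
      qed (use e in auto)
    qed (use J0 in auto)
    have "wp (For ''e'' ''m'' edge_step) ?s t2 (\<lambda>s' t'.
        wp (If (Less (Var ''k'') (Var ''W'')) Skip (''answer'' ::= N 1)) s' t' ?Q)"
      if t2: "t2 \<le> t1 + 20" for t2
    proof (rule wp_conseq[OF loop])
      fix s3 t3 assume 3: "?J m s3 \<and> t3 \<le> t2 + Suc m * (?T + 16)"
      have "?W \<inter> {..<m} = ?W" by (auto simp: weak_edges_def)
      with 3 have W: "s3 ''W'' 0 = card ?W" "s3 ''k'' 0 = k" by (simp_all add: env_def)
      have "t3 + 20 \<le> t + 1200 * (m * (n + c))" using 3 t2 1 T1 T2 mn1 by linarith
      moreover have "\<forall>j<length L. \<phi> (L ! j) = s ''y'' j" using 1 by (simp add: \<phi>_def)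
      ultimately show "wp (If (Less (Var ''k'') (Var ''W'')) Skip (''answer'' ::= N 1)) s3 t3 ?Q"
        using 3 W by (auto intro!: exI[of _ \<phi>])
    qed
    then show "wp (''W'' ::= N 0) s1 t1 (\<lambda>s' t'. wp (For ''e'' ''m'' edge_step) s' t' (\<lambda>s' t'.
        wp (If (Less (Var ''k'') (Var ''W'')) Skip (''answer'' ::= N 1)) s' t' ?Q))"
      by (simp only: wp_Wr aval.simps acost.simps)
  qed
qed

definition good :: "nat list \<Rightarrow> (nat \<Rightarrow> nat) \<Rightarrow> bool" where
  "good L z \<longleftrightarrow> (\<exists>\<phi>. (\<forall>j<length L. \<phi> (L ! j) = z j) \<and> card (weak_edges (set L) \<phi>) \<le> k)"

text \<open>All functions that agree with \<open>z\<close> along \<open>L\<close> have the same weak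
  edges, so any one of them decides the existential in \<open>good\<close>.\<close>

lemma good_iff:
  assumes "\<forall>j<length L. \<phi> (L ! j) = z j"
  shows "good L z \<longleftrightarrow> card (weak_edges (set L) \<phi>) \<le> k"
proof
  assume "good L z"
  then obtain \<psi> where p: "\<forall>j<length L. \<psi> (L ! j) = z j" "card (weak_edges (set L) \<psi>) \<le> k"
    unfolding good_def by blast
  have "weak_edges (set L) \<psi> = weak_edges (set L) \<phi>"
  proof (rule weak_edges_cong)
    fix f assume "f \<in> set L"
    then obtain j where "j < length L" "L ! j = f" unfolding in_set_conv_nth by blast
    with assms p(1) show "\<psi> f = \<phi> f" by auto
  qed
  with p(2) show "card (weak_edges (set L) \<phi>) \<le> k" by simp
next
  assume "card (weak_edges (set L) \<phi>) \<le> k"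
  with assms show "good L z" unfolding good_def by blast
qed

lemma good_cong: "(\<And>j. j < length L \<Longrightarrow> z j = z' j) \<Longrightarrow> good L z = good L z'"
  by (simp add: good_def)

text \<open>This makes the enumeration exhaustive: a solution is represented by one digit per cover
  edge, with 0 standing for weak.\<close>

lemma el_multi_stc_iff_good:
  assumes C: "cover (set L)"
  shows "el_multi_stc E c k \<Psi> \<longleftrightarrow> (\<exists>z. (\<forall>j<length L. z j \<le> c) \<and> good L z)"
proof
  assume "el_multi_stc E c k \<Psi>"
  from weak_edges_if_el_multi_stc[OF this, of "set L"] obtain \<phi> where
    p: "\<forall>e. \<phi> e \<le> c" "card (weak_edges (set L) (\<lambda>e. if e \<in> set L then \<phi> e else 0)) \<le> k" by blast
  then have "good L (\<lambda>j. \<phi> (L ! j))"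
    unfolding good_def by (intro exI[of _ "\<lambda>e. if e \<in> set L then \<phi> e else 0"]) simp
  with p(1) show "\<exists>z. (\<forall>j<length L. z j \<le> c) \<and> good L z"
    by (intro exI[of _ "\<lambda>j. \<phi> (L ! j)"]) simp
next
  assume "\<exists>z. (\<forall>j<length L. z j \<le> c) \<and> good L z"
  then show "el_multi_stc E c k \<Psi>"
    using el_multi_stc_if_weak_edges[OF C] unfolding good_def by blast
qed

lemma wp_color_all:
  assumes s: "env s" and L: "cov_rep L s" "distinct L" "cover (set L)" "length L \<le> k1 E"
    and mark: "\<And>\<alpha>. s ''mark'' \<alpha> \<le> s ''st'' 0" and mn: "0 < m" "0 < n"
    and y: "\<And>j. s ''y'' j = 0" and ov: "s ''ov'' 0 = 0" and answer: "s ''answer'' 0 = 0"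
  shows "wp color_all s t (\<lambda>s' t'. s' ''answer'' 0 = (if el_multi_stc E c k \<Psi> then 1 else 0) \<and>
     t' \<le> t + 2800 * (Suc c ^ k1 E * (m * (n + c))))"
proof -
  let ?b = "Suc c" and ?K = "length L"
  let ?P = "\<lambda>i. \<exists>z. (\<forall>j<?K. z j \<le> c) \<and> val ?b ?K z < i \<and> good L z"
  let ?B = "?b ^ ?K"
  define T where "T = 1200 * (m * (n + c)) + 60 * Suc m"
  \<comment> \<open>The index is the value of the current vector while the loop is running, and
    \<open>?B\<close> once the last increment has overflowed.\<close>
  let ?I = "\<lambda>i s'. env s' \<and> cov_rep L s' \<and> (\<forall>\<alpha>. s' ''mark'' \<alpha> \<le> s' ''st'' 0) \<and>
    (\<forall>j<?K. s' ''y'' j \<le> c) \<and> s' ''answer'' 0 = (if ?P i then 1 else 0) \<and>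
    (if s' ''ov'' 0 = 0 then i = val ?b ?K (s' ''y'') \<and> i < ?B else i = ?B)"
  have len: "?K \<le> m" using L(4) k1_le by simp
  have step: "i < ?B \<and> wp (evaluate;; inc ''y'' ''J'') s t (\<lambda>s' t'. ?I (Suc i) s' \<and> t' \<le> t + T)"
    if I: "?I i s" and g: "bval (Eq (Var ''ov'') (N 0)) s" for i s t
  proof -
    let ?y = "s ''y''"
    have i: "i = val ?b ?K ?y" "i < ?B" using I g by auto
    have yc: "\<And>j. j < ?K \<Longrightarrow> ?y j \<le> c" using I by blast
    \<comment> \<open>By \<open>val_inj\<close> only the current vector has value \<open>i\<close>,
      up to digits from index \<open>?K\<close> on, which \<open>good\<close> ignores.\<close>
    have P: "?P (Suc i) \<longleftrightarrow> ?P i \<or> good L ?y"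
    proof
      assume "?P (Suc i)"
      then obtain z where z: "\<forall>j<?K. z j \<le> c" "val ?b ?K z < Suc i" "good L z" by blast
      show "?P i \<or> good L ?y"
      proof (cases "val ?b ?K z < i")
        case False
        with z i have "val ?b ?K z = val ?b ?K ?y" by simp
        then have "z j = ?y j" if "j < ?K" for j
          using val_inj[of ?K z ?b ?y j] that z(1) yc by (simp add: less_Suc_eq_le)
        with z(3) show ?thesis using good_cong by blast
      qed (use z in blast)
    next
      assume "?P i \<or> good L ?y"
      then show "?P (Suc i)"
      proof
        assume "good L ?y"
        then show ?thesis using yc i by (intro exI[of _ ?y]) simp
      qed (auto intro: less_SucI)
    qed
    have "wp (evaluate;; inc ''y'' ''J'') s t (\<lambda>s' t'. ?I (Suc i) s' \<and> t' \<le> t + T)"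
      unfolding wp_Seq
    proof (rule wp_conseq[OF wp_evaluate[of s L]])
      fix s1 t1 assume 1: "(\<exists>\<phi>. (\<forall>j<?K. \<phi> (L ! j) = s ''y'' j) \<and>
          s1 ''answer'' 0 = (if card (weak_edges (set L) \<phi>) \<le> k then 1 else s ''answer'' 0)) \<and>
          (\<forall>\<alpha>. s1 ''mark'' \<alpha> \<le> s1 ''st'' 0) \<and> t1 \<le> t + 1200 * (m * (n + c))"
        and fr: "\<And>x. x \<notin> writes evaluate \<Longrightarrow> s1 x = s x"
      have env: "env s1" using I env_cong[of s1 s] by (simp add: fr)
      have cov: "cov_rep L s1" using I cov_rep_cong[of s1 s] by (simp add: fr)
      have ans: "s1 ''answer'' 0 = (if ?P (Suc i) then 1 else 0)"
      proof -
        from 1 obtain \<phi> where p: "\<forall>j<?K. \<phi> (L ! j) = ?y j"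
          "s1 ''answer'' 0 = (if card (weak_edges (set L) \<phi>) \<le> k then 1 else s ''answer'' 0)" by blast
        have "s ''answer'' 0 = (if ?P i then 1 else 0)" using I by blast
        then show ?thesis using p(2) unfolding P good_iff[OF p(1)] by (simp only: split: if_split) blast
      qed
      have y1: "s1 ''y'' = ?y" by (simp add: fr)
      show "wp (inc ''y'' ''J'') s1 t1 (\<lambda>s' t'. ?I (Suc i) s' \<and> t' \<le> t + T)"
      proof (rule wp_conseq[OF wp_inc[where c = c and K = ?K]])
        fix s2 t2 assume 2: "(\<forall>j<?K. s2 ''y'' j \<le> c) \<and> (\<forall>j\<ge>?K. s2 ''y'' j = s1 ''y'' j) \<and>
          (if Suc (val ?b ?K (s1 ''y'')) < ?b ^ ?K
           then s2 ''ov'' 0 = 0 \<and> val ?b ?K (s2 ''y'') = Suc (val ?b ?K (s1 ''y''))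
           else s2 ''ov'' 0 = 1 \<and> Suc (val ?b ?K (s1 ''y'')) = ?b ^ ?K \<and> (\<forall>j<?K. s2 ''y'' j = 0)) \<and>
          t2 \<le> t1 + 60 * Suc ?K"
          and fr: "\<And>x. x \<notin> writes (inc ''y'' ''J'') \<Longrightarrow> s2 x = s1 x"
        have "env s2" using env env_cong[of s2 s1] by (simp add: fr)
        moreover have "cov_rep L s2" using cov cov_rep_cong[of s2 s1] by (simp add: fr)
        moreover have "\<forall>\<alpha>. s2 ''mark'' \<alpha> \<le> s2 ''st'' 0" using 1 by (simp add: fr)
        moreover have "s2 ''answer'' = s1 ''answer''" by (simp add: fr)
        then have "s2 ''answer'' 0 = (if ?P (Suc i) then 1 else 0)" by (simp only: ans)
        moreover have "if s2 ''ov'' 0 = 0 then Suc i = val ?b ?K (s2 ''y'') \<and> Suc i < ?B else Suc i = ?B"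
          using 2 i(1) unfolding y1 by (auto split: if_splits)
        moreover have "t2 \<le> t + T"
        proof -
          have "60 * Suc ?K \<le> 60 * Suc m" using len by simp
          with 1 2 show ?thesis unfolding T_def by linarith
        qed
        ultimately show "?I (Suc i) s2 \<and> t2 \<le> t + T" using 2 by blast
      qed (use env cov yc y1 in \<open>auto simp: env_def cov_rep_def\<close>)
    qed (use I L mn len in auto)
    with i(2) show ?thesis by simp
  qed
  have "1 \<le> m * (n + c)" using mn nat_0_less_mult_iff[of m "n + c"] by linarith
  moreover have "m \<le> m * (n + c)" using mn by simp
  moreover from calculation have "Suc m \<le> 2 * (m * (n + c))" by linarith
  from mult_le_mono2[OF this, of 60] have "60 * Suc m \<le> 120 * (m * (n + c))" by simp
  ultimately have "60 * Suc m + 10 \<le> 130 * (m * (n + c))" by linarith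
  then have "T + 1 + bcost (Eq (Var ''ov'') (N 0)) \<le> 1400 * (m * (n + c))"
    unfolding T_def by simp
  \<comment> \<open>The exponent of the time bound arises here: the cover found has at most
    \<open>k1 E\<close> edges.\<close>
  moreover have "?B \<le> ?b ^ k1 E" using L(4) by (intro power_increasing) auto
  then have "Suc ?B \<le> 2 * ?b ^ k1 E" using one_le_power[of ?b "k1 E"] by linarith
  ultimately have "Suc (?B - 0) * (T + 1 + bcost (Eq (Var ''ov'') (N 0))) \<le> (2 * ?b ^ k1 E) * (1400 * (m * (n + c)))"
    by (intro mult_mono) auto
  then have T: "Suc (?B - 0) * (T + 1 + bcost (Eq (Var ''ov'') (N 0))) \<le> 2800 * (?b ^ k1 E * (m * (n + c)))"
    by (simp only: mult_ac)
  show ?thesis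
    unfolding color_all_def
  proof (rule wp_conseq[OF wp_While[where I = ?I and i = 0 and B = ?B and T = T]])
    show "?I 0 s" using s L mark y ov answer by (simp add: val_def)
    fix s' t' assume fin: "(\<exists>j\<le>?B. ?I j s') \<and> \<not> bval (Eq (Var ''ov'') (N 0)) s' \<and>
      t' \<le> t + Suc (?B - 0) * (T + 1 + bcost (Eq (Var ''ov'') (N 0)))"
    then obtain j where j: "?I j s'" by blast
    then have "s' ''answer'' 0 = (if ?P ?B then 1 else 0)" using fin by auto
    moreover have "?P ?B \<longleftrightarrow> el_multi_stc E c k \<Psi>"
    proof -
      have "val ?b ?K z < ?B" if "\<forall>j<?K. z j \<le> c" for z
        using that by (intro val_less) (simp add: less_Suc_eq_le)
      then show ?thesis unfolding el_multi_stc_iff_good[OF L(3)] by blast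
    qed
    moreover have "t' \<le> t + 2800 * (Suc c ^ k1 E * (m * (n + c)))" using fin T by linarith
    ultimately show "s' ''answer'' 0 = (if el_multi_stc E c k \<Psi> then 1 else 0) \<and>
      t' \<le> t + 2800 * (Suc c ^ k1 E * (m * (n + c)))" by simp
  qed (use step in auto)
qed

end

section \<open>Preprocessing\<close>

text \<open>Repeated addition stands in for the product \<open>i * n\<close>; entry 0 is correct
  because memory starts out as 0.\<close>

definition prep_off :: com where
  "prep_off = For ''i'' ''n''
     (Wr ''off'' (Plus (Var ''i'') (N 1)) (Plus (Rd ''off'' (Var ''i'')) (Var ''n'')))"

definition prep_adj :: com where
  "prep_adj = For ''i'' ''m''
     (Wr ''row'' (Plus (Var ''i'') (N 1)) (Plus (Rd ''row'' (Var ''i'')) (Var ''c''));;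
      Wr ''adj'' (Plus (Rd ''off'' (Rd ''u'' (Var ''i''))) (Rd ''v'' (Var ''i''))) (Plus (Var ''i'') (N 1));;
      Wr ''adj'' (Plus (Rd ''off'' (Rd ''v'' (Var ''i''))) (Rd ''u'' (Var ''i''))) (Plus (Var ''i'') (N 1)))"

text \<open>The first branch guarantees a base of at least 2 and a nonempty graph for the
  enumerations. Without colors or without edges, labeling everything weak is the only
  option.\<close>

definition stc_program :: com where
  "stc_program =
     If (And (Less (N 0) (Var ''c'')) (Less (N 0) (Var ''m'')))
       (prep_off;; prep_adj;; search;; ''ov'' ::= N 0;; color_all)
       (If (Less (Var ''k'') (Var ''m'')) Skip (''answer'' ::= N 1))"

lemma writes_prep_off [simp]: "writes prep_off = {''i'', ''off''}"
  by (simp add: prep_off_def)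

lemma writes_prep_adj [simp]: "writes prep_adj = {''i'', ''row'', ''adj''}"
  by (auto simp: prep_adj_def)

lemma writes_search [simp]:
  "writes search = {''it'', ''J'', ''e'', ''w'', ''f'', ''g'', ''in'', ''cov'', ''i'', ''x'', ''ov'', ''K''}"
  by (auto simp: search_def)

lemma row_major_inj:
  assumes "b < n" "v < n"
  shows "a * n + b = u * n + v \<longleftrightarrow> a = u \<and> b = (v :: nat)"
proof
  assume eq: "a * n + b = u * n + v"
  have "(a * n + b) div n = a" "(u * n + v) div n = u" using assms by auto
  with eq have "a = u" by metis
  with eq show "a = u \<and> b = v" by simp
qed simp

section \<open>Correctness of the tables, and the total running time\<close>

context multi_stc
begin

abbreviation s0 :: state where "s0 \<equiv> input_state n es c k \<Psi>"

lemma input_scalars: "s0 ''n'' 0 = n" "s0 ''m'' 0 = m" "s0 ''c'' 0 = c" "s0 ''k'' 0 = k"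
  by (simp_all add: input_state_def)

lemma input_uv: "i < m \<Longrightarrow> s0 ''u'' i = fst (es ! i)" "i < m \<Longrightarrow> s0 ''v'' i = snd (es ! i)"
  by (simp_all add: input_state_def)

lemma input_psi:
  assumes "i < m" "a < c"
  shows "s0 ''psi'' (i * c + a) = (if Suc a \<in> \<Psi> (ed i) then 1 else 0)"
proof -
  have "i * c + a < Suc i * c" using assms(2) by simp
  also have "\<dots> \<le> m * c" using assms(1) by (intro mult_le_mono1) simp
  finally show ?thesis using assms(2) by (simp add: input_state_def ed_def)
qed

lemma input_zero:
  "x \<notin> {''n'', ''m'', ''c'', ''k'', ''u'', ''v'', ''psi''} \<Longrightarrow> s0 x = (\<lambda>_. 0)"
  by (simp add: input_state_def)

lemma wp_prep_off:
  assumes "s ''n'' 0 = n" "s ''off'' 0 = 0"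
  shows "wp prep_off s t (\<lambda>s' t'. (\<forall>j\<le>n. s' ''off'' j = j * n) \<and> t' \<le> t + Suc n * (20 + 16))"
  unfolding prep_off_def
  by (rule wp_For[where I = "\<lambda>i s'. \<forall>j\<le>i. s' ''off'' j = j * n"]) (use assms in \<open>auto simp: le_Suc_eq\<close>)

lemma wp_prep_adj:
  assumes s: "s ''m'' 0 = m" "s ''c'' 0 = c" "s ''row'' 0 = 0" "\<And>i. s ''adj'' i = 0"
    and off: "\<forall>j\<le>n. s ''off'' j = j * n"
    and uv: "\<forall>i<m. s ''u'' i = fst (es ! i) \<and> s ''v'' i = snd (es ! i)"
  shows "wp prep_adj s t (\<lambda>s' t'. (\<forall>j\<le>m. s' ''row'' j = j * c) \<and>
     (\<forall>a<n. \<forall>b<n. s' ''adj'' (a * n + b) = adjn a b) \<and> t' \<le> t + Suc m * (60 + 16))"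
proof -
  \<comment> \<open>Cells are described by their positive contents only, so the invariant holds for
    cleared memory at \<open>i = 0\<close>, and missing edges need no write.\<close>
  let ?I = "\<lambda>i s'. s' ''c'' 0 = c \<and> s' ''off'' = s ''off'' \<and> s' ''u'' = s ''u'' \<and> s' ''v'' = s ''v'' \<and>
    (\<forall>j\<le>i. s' ''row'' j = j * c) \<and>
    (\<forall>a<n. \<forall>b<n. \<forall>j. s' ''adj'' (a * n + b) = Suc j \<longleftrightarrow> j < i \<and> ed j = {a, b})"
  have loop: "wp prep_adj s t (\<lambda>s' t'. ?I m s' \<and> t' \<le> t + Suc m * (60 + 16))"
    unfolding prep_adj_def
  proof (rule wp_For[where I = ?I])
    fix i s1 t1 assume i: "i < m" "?I i s1" "s1 ''i'' 0 = i"
    let ?u = "fst (es ! i)" and ?v = "snd (es ! i)"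
    let ?adj = "(s1 ''adj'')(?u * n + ?v := Suc i, ?v * n + ?u := Suc i)"
    have uvn: "?u < n" "?v < n" using ends_less[OF i(1)] by auto
    have adj: "?adj (a * n + b) = Suc j \<longleftrightarrow> j < Suc i \<and> ed j = {a, b}" if "a < n" "b < n" for a b j
    proof (cases "ed i = {a, b}")
      case True
      then have "a = ?u \<and> b = ?v \<or> a = ?v \<and> b = ?u" unfolding ed_def doubleton_eq_iff by blast
      then have "?adj (a * n + b) = Suc i" by (elim disjE conjE) simp_all
      moreover have "j < Suc i \<and> ed j = {a, b} \<longleftrightarrow> j = i"
        using True i(1) ed_eq[of j i] by fastforce
      ultimately show ?thesis by (simp only:) auto
    next
      case False
      then have "\<not> (a = ?u \<and> b = ?v)" "\<not> (a = ?v \<and> b = ?u)" unfolding ed_def by (metis insert_commute)+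
      then have "a * n + b \<noteq> ?u * n + ?v" "a * n + b \<noteq> ?v * n + ?u"
        using row_major_inj[OF that(2) uvn(2)] row_major_inj[OF that(2) uvn(1)] by blast+
      then have "?adj (a * n + b) = s1 ''adj'' (a * n + b)" by simp
      moreover have "s1 ''adj'' (a * n + b) = Suc j \<longleftrightarrow> j < i \<and> ed j = {a, b}"
        using i(2) that by blast
      ultimately show ?thesis using False less_Suc_eq[of j i] by metis
    qed
    have row: "\<forall>j\<le>Suc i. ((s1 ''row'')(Suc i := s1 ''row'' i + c)) j = j * c"
      using i(2) by (auto simp: le_Suc_eq)
    have "s1 ''off'' ?u = ?u * n" "s1 ''off'' ?v = ?v * n" "s1 ''u'' i = ?u" "s1 ''v'' i = ?v"
      using i off uv uvn by auto
    then show "wp (Wr ''row'' (Plus (Var ''i'') (N 1)) (Plus (Rd ''row'' (Var ''i'')) (Var ''c''));;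
      Wr ''adj'' (Plus (Rd ''off'' (Rd ''u'' (Var ''i''))) (Rd ''v'' (Var ''i''))) (Plus (Var ''i'') (N 1));;
      Wr ''adj'' (Plus (Rd ''off'' (Rd ''v'' (Var ''i''))) (Rd ''u'' (Var ''i''))) (Plus (Var ''i'') (N 1)))
      s1 t1 (\<lambda>s' t'. ?I (Suc i) (s'(''i'' := (s' ''i'')(0 := Suc i))) \<and> t' \<le> t1 + 60)"
      using i(2,3) adj row by (simp del: fun_upd_apply add: fun_upd_same fun_upd_other)
  qed (use s in auto)
  show ?thesis
  proof (rule wp_conseq[OF loop])
    fix s' t' assume 1: "?I m s' \<and> t' \<le> t + Suc m * (60 + 16)"
    have "s' ''adj'' (a * n + b) = adjn a b" if "a < n" "b < n" for a b
    proof -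
      have "s' ''adj'' (a * n + b) = Suc j \<longleftrightarrow> adjn a b = Suc j" for j
        using 1 that by (simp add: adjn_eq_Suc)
      then show ?thesis by (metis not0_implies_Suc)
    qed
    with 1 show "(\<forall>j\<le>m. s' ''row'' j = j * c) \<and>
     (\<forall>a<n. \<forall>b<n. s' ''adj'' (a * n + b) = adjn a b) \<and> t' \<le> t + Suc m * (60 + 16)" by blast
  qed
qed

lemma el_multi_stc_trivial: 
  assumes "c = 0 \<or> m = 0"
  shows "el_multi_stc E c k \<Psi> \<longleftrightarrow> m \<le> k"
proof
  assume "el_multi_stc E c k \<Psi>"
  then obtain L where "c_labeling E c L" "card (weak L) \<le> k"
    unfolding el_multi_stc_def stc_labeling_def by blast
  moreover from this(1) have "weak L = E" if "c = 0" using that by (auto simp: c_labeling_def)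
  ultimately show "m \<le> k" using assms card_E by auto
next
  assume "m \<le> k"
  then show "el_multi_stc E c k \<Psi>"
    unfolding el_multi_stc_def
    by (intro exI[of _ "Labeling (\<lambda>_. {}) E"])
       (simp add: stc_labeling_def c_labeling_def psi_satisfying_def disjoint_family_on_def card_E)
qed

text \<open>The product in the bound is 0 for a graph without edges, while every run takes some
  time; \<open>max 1\<close> covers this case.\<close>

lemma wp_stc_program:
  "wp stc_program s0 0 (\<lambda>s t. answer s = (if el_multi_stc E c k \<Psi> then 1 else 0) \<and>
     t \<le> 6700 * max 1 ((c + 1) ^ k1 E * (c * card E + n * card E)))"
proof (cases "0 < c \<and> 0 < m")
  case False
  then have "el_multi_stc E c k \<Psi> \<longleftrightarrow> m \<le> k" by (intro el_multi_stc_trivial) auto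
  with False show ?thesis
    by (auto simp: stc_program_def input_scalars answer_def input_zero)
next
  case True
  then have c: "0 < c" and m: "0 < m" by auto
  have n: "0 < n" using ends_less[OF m] by linarith
  let ?N = "m * (n + c)" and ?B = "Suc c ^ k1 E"
  let ?T = "6700 * (?B * ?N)"
  let ?Q = "\<lambda>s t. answer s = (if el_multi_stc E c k \<Psi> then 1 else 0) \<and> t \<le> ?T"
  have N1: "1 \<le> ?N" using m n nat_0_less_mult_iff[of m "n + c"] by linarith
  have "n + c \<le> ?N" using m by (simp add: Suc_le_eq)
  then have "Suc n \<le> 2 * ?N" using N1 by linarith
  from mult_le_mono1[OF this, of 36] have T1: "Suc n * (20 + 16) \<le> 72 * ?N" by simp
  have "m \<le> ?N" using n by simp
  then have "Suc m \<le> 2 * ?N" using N1 by linarith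
  from mult_le_mono1[OF this, of 76] have T2: "Suc m * (60 + 16) \<le> 152 * ?N" by simp
  have BN: "?N \<le> ?B * ?N" by simp
  have "m * n \<le> ?N" by simp
  then have T3: "?B * (m * n) \<le> ?B * ?N" by (rule mult_le_mono2)
  have start: "wp prep_off s0 t (\<lambda>s1 t1. wp prep_adj s1 t1 (\<lambda>s2 t2. wp search s2 t2 (\<lambda>s3 t3.
      wp (''ov'' ::= N 0) s3 t3 (\<lambda>s4 t4. wp color_all s4 t4 ?Q))))" if t: "t \<le> 20" for t
  proof (rule wp_conseq[OF wp_prep_off])
    fix s1 t1 assume 1: "(\<forall>j\<le>n. s1 ''off'' j = j * n) \<and> t1 \<le> t + Suc n * (20 + 16)"
      and fr1: "\<And>x. x \<notin> writes prep_off \<Longrightarrow> s1 x = s0 x"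
    show "wp prep_adj s1 t1 (\<lambda>s2 t2. wp search s2 t2 (\<lambda>s3 t3.
      wp (''ov'' ::= N 0) s3 t3 (\<lambda>s4 t4. wp color_all s4 t4 ?Q)))"
    proof (rule wp_conseq[OF wp_prep_adj])
      fix s2 t2 assume 2: "(\<forall>j\<le>m. s2 ''row'' j = j * c) \<and>
          (\<forall>a<n. \<forall>b<n. s2 ''adj'' (a * n + b) = adjn a b) \<and> t2 \<le> t1 + Suc m * (60 + 16)"
        and fr2: "\<And>x. x \<notin> writes prep_adj \<Longrightarrow> s2 x = s1 x"
      have env: "env s2"
        unfolding env_def using 1 2 by (simp add: fr1 fr2 input_scalars input_uv input_psi)
      have zero: "s2 x = (\<lambda>_. 0)" if "x \<notin> env_vars \<union> {''i''}" for x
        using that by (simp add: fr1 fr2 input_zero)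
      show "wp search s2 t2 (\<lambda>s3 t3. wp (''ov'' ::= N 0) s3 t3 (\<lambda>s4 t4. wp color_all s4 t4 ?Q))"
      proof (rule wp_conseq[OF wp_search])
        fix s3 t3 assume 3: "(\<exists>L. cov_rep L s3 \<and> cover (set L) \<and> distinct L \<and> length L \<le> k1 E) \<and>
            t3 \<le> t2 + 3300 * (?B * (m * n))"
          and fr3: "\<And>x. x \<notin> writes search \<Longrightarrow> s3 x = s2 x"
        then obtain L where L: "cov_rep L s3" "cover (set L)" "distinct L" "length L \<le> k1 E" by blast
        have env3: "env s3" using env env_cong[of s3 s2] by (simp add: fr3)
        let ?s = "s3(''ov'' := (s3 ''ov'')(0 := 0))"
        have "wp color_all ?s t4 ?Q" if t4: "t4 \<le> t3 + 3" for t4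
        proof (rule wp_conseq[OF wp_color_all[of ?s L]])
          fix s5 :: state and t5 assume 5: "s5 ''answer'' 0 = (if el_multi_stc E c k \<Psi> then 1 else 0) \<and>
            t5 \<le> t4 + 2800 * (?B * ?N)"
          \<comment> \<open>The coefficients 72 + 152 + 3300 + 2800 of the phases and the constant
            part 23 stay below 6700.\<close>
          have "t5 \<le> ?T" using t 1 2 3 t4 5 T1 T2 T3 BN N1 by linarith
          with 5 show "?Q s5 t5" by (simp add: answer_def)
        qed (use env3 L m n in \<open>simp_all add: fr3 zero\<close>)
        then show "wp (''ov'' ::= N 0) s3 t3 (\<lambda>s4 t4. wp color_all s4 t4 ?Q)" by simp
      qed (use env m n c in \<open>simp_all add: zero\<close>)
    qed (use 1 in \<open>simp_all add: fr1 input_scalars input_uv input_zero\<close>)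
  qed (simp_all add: input_scalars input_zero)
  have "?B * ?N = (c + 1) ^ k1 E * (c * card E + n * card E)"
    by (simp add: card_E algebra_simps)
  then have T: "?T \<le> 6700 * max 1 ((c + 1) ^ k1 E * (c * card E + n * card E))" by simp
  have "wp stc_program s0 0 ?Q"
    unfolding stc_program_def using start True by (simp add: input_scalars)
  then show ?thesis by (rule wp_conseq) (use T in auto)
qed

end

theorem theorem3:
  "\<exists>(p :: com) (C :: nat).
     \<forall>(n :: nat) (E :: nat set set) (c :: nat) (k :: nat) (\<Psi> :: nat set \<Rightarrow> nat set)
       (es :: (nat \<times> nat) list).
       simple_graph {..<n} E \<longrightarrow> (\<forall>e\<in>E. \<Psi> e \<subseteq> {1..c}) \<longrightarrow> lists_edges es E \<longrightarrow>
       (\<exists>t s. exec p (input_state n es c k \<Psi>) t s \<and>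
              answer s = (if el_multi_stc E c k \<Psi> then 1 else 0) \<and>
              t \<le> C * max 1 ((c + 1) ^ k1 E * (c * card E + n * card E)))"
proof (rule exI[of _ stc_program], rule exI[of _ 6700], intro allI impI)
  fix n c k :: nat and E :: "nat set set" and \<Psi> :: "nat set \<Rightarrow> nat set" and es :: "(nat \<times> nat) list"
  assume "simple_graph {..<n} E" "\<forall>e\<in>E. \<Psi> e \<subseteq> {1..c}" "lists_edges es E"
  then interpret multi_stc n c k E \<Psi> es by unfold_locales
  from wp_stc_program show "\<exists>t s. exec stc_program (input_state n es c k \<Psi>) t s \<and>
      answer s = (if el_multi_stc E c k \<Psi> then 1 else 0) \<and>
      t \<le> 6700 * max 1 ((c + 1) ^ k1 E * (c * card E + n * card E))"
    unfolding wp_def by auto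
qed

end
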